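(* Let $n \geq 2$ be an integer and let $W = \mathbb{F}^n$. Natural representations of $\mathfrak{sl}(n^\infty)$ are parameterised by tails of sequences of points $p_1, p_2, \dots \in \mathbb{P}(W)$, that is, by equivalence classes of sequences of points under the relation $(p_\bullet) \sim (q_\bullet)$ if $p_k = q_k$ for $k \gg 0$.
   Context: $\mathbb{F}$ is an algebraically closed field of characteristic $0$. The Lie algebra $\mathfrak{sl}(n^\infty)$ is the direct limit of $\mathfrak{sl}(n) \to \mathfrak{sl}(n^2) \to \mathfrak{sl}(n^3) \to \cdots$, where each map sends $M$ to the block diagonal matrix $\operatorname{diag}(M, \dots, M)$ with $n$ copies of $M$. The natural representation of $\mathfrak{sl}(m)$ is $\mathbb{F}^m$, viewed as column vectors with the action by left multiplication. A natural representation of $\mathfrak{sl}(n^\infty)$ is a direct limit of the natural representations of the $\mathfrak{sl}(n^k)$, where the transition maps $\mathbb{F}^{n^k} \to \mathbb{F}^{n^{k+1}}$ are nonzero $\mathfrak{sl}(n^k)$-module homomorphisms. $\mathbb{P}(W)$ is the projective space of lines in $W$. *)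

theory Defs
  imports "Jordan_Normal_Form.VS_Connect"
begin

section \<open>Lie algebras and their modules\<close>

record ('a, 'g) lie_algebra = "('a, 'g) module" +
  lie_bracket :: "'g \<Rightarrow> 'g \<Rightarrow> 'g"

locale lie_algebra = vectorspace K L
  for K :: "('a, 'k) ring_scheme" and L :: "('a, 'g, 'l) lie_algebra_scheme" (structure) +
  assumes bracket_closed:
      "x \<in> carrier L \<Longrightarrow> y \<in> carrier L \<Longrightarrow> lie_bracket L x y \<in> carrier L"
    and bracket_add_left:
      "x \<in> carrier L \<Longrightarrow> y \<in> carrier L \<Longrightarrow> z \<in> carrier L \<Longrightarrow>
        lie_bracket L (x \<oplus>\<^bsub>L\<^esub> y) z = lie_bracket L x z \<oplus>\<^bsub>L\<^esub> lie_bracket L y z"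
    and bracket_add_right:
      "x \<in> carrier L \<Longrightarrow> y \<in> carrier L \<Longrightarrow> z \<in> carrier L \<Longrightarrow>
        lie_bracket L x (y \<oplus>\<^bsub>L\<^esub> z) = lie_bracket L x y \<oplus>\<^bsub>L\<^esub> lie_bracket L x z"
    and bracket_smult_left:
      "c \<in> carrier K \<Longrightarrow> x \<in> carrier L \<Longrightarrow> y \<in> carrier L \<Longrightarrow>
        lie_bracket L (c \<odot>\<^bsub>L\<^esub> x) y = c \<odot>\<^bsub>L\<^esub> lie_bracket L x y"
    and bracket_smult_right:
      "c \<in> carrier K \<Longrightarrow> x \<in> carrier L \<Longrightarrow> y \<in> carrier L \<Longrightarrow>
        lie_bracket L x (c \<odot>\<^bsub>L\<^esub> y) = c \<odot>\<^bsub>L\<^esub> lie_bracket L x y"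
    and bracket_self: "x \<in> carrier L \<Longrightarrow> lie_bracket L x x = \<zero>\<^bsub>L\<^esub>"
    and jacobi:
      "x \<in> carrier L \<Longrightarrow> y \<in> carrier L \<Longrightarrow> z \<in> carrier L \<Longrightarrow>
        lie_bracket L x (lie_bracket L y z) \<oplus>\<^bsub>L\<^esub> lie_bracket L y (lie_bracket L z x)
          \<oplus>\<^bsub>L\<^esub> lie_bracket L z (lie_bracket L x y) = \<zero>\<^bsub>L\<^esub>"

record ('a, 'g, 'v) lie_module = "('a, 'v) module" +
  act :: "'g \<Rightarrow> 'v \<Rightarrow> 'v"

locale lie_module = L: lie_algebra K L + V: vectorspace K V
  for K :: "('a, 'k) ring_scheme" and L :: "('a, 'g, 'l) lie_algebra_scheme"
    and V :: "('a, 'g, 'v, 'm) lie_module_scheme" +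
  assumes act_closed: "x \<in> carrier L \<Longrightarrow> v \<in> carrier V \<Longrightarrow> act V x v \<in> carrier V"
    and act_add_left:
      "x \<in> carrier L \<Longrightarrow> y \<in> carrier L \<Longrightarrow> v \<in> carrier V \<Longrightarrow>
        act V (x \<oplus>\<^bsub>L\<^esub> y) v = act V x v \<oplus>\<^bsub>V\<^esub> act V y v"
    and act_add_right:
      "x \<in> carrier L \<Longrightarrow> u \<in> carrier V \<Longrightarrow> v \<in> carrier V \<Longrightarrow>
        act V x (u \<oplus>\<^bsub>V\<^esub> v) = act V x u \<oplus>\<^bsub>V\<^esub> act V x v"
    and act_smult_left:
      "c \<in> carrier K \<Longrightarrow> x \<in> carrier L \<Longrightarrow> v \<in> carrier V \<Longrightarrow>
        act V (c \<odot>\<^bsub>L\<^esub> x) v = c \<odot>\<^bsub>V\<^esub> act V x v"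
    and act_smult_right:
      "c \<in> carrier K \<Longrightarrow> x \<in> carrier L \<Longrightarrow> v \<in> carrier V \<Longrightarrow>
        act V x (c \<odot>\<^bsub>V\<^esub> v) = c \<odot>\<^bsub>V\<^esub> act V x v"
    and act_bracket:
      "x \<in> carrier L \<Longrightarrow> y \<in> carrier L \<Longrightarrow> v \<in> carrier V \<Longrightarrow>
        act V (lie_bracket L x y) v = act V x (act V y v) \<ominus>\<^bsub>V\<^esub> act V y (act V x v)"

definition lie_module_hom ::
  "('a, 'k) ring_scheme \<Rightarrow> ('a, 'g, 'l) lie_algebra_scheme \<Rightarrow>
   ('a, 'g, 'u, 'm) lie_module_scheme \<Rightarrow> ('a, 'g, 'v, 'm2) lie_module_scheme \<Rightarrow> ('u \<Rightarrow> 'v) set"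
  where "lie_module_hom K L U V =
    {h \<in> LinearCombinations.module_hom K U V.
      \<forall>x \<in> carrier L. \<forall>u \<in> carrier U. h (act U x u) = act V x (h u)}"

definition lie_module_isomorphic ::
  "('a, 'k) ring_scheme \<Rightarrow> ('a, 'g, 'l) lie_algebra_scheme \<Rightarrow>
   ('a, 'g, 'u, 'm) lie_module_scheme \<Rightarrow> ('a, 'g, 'v, 'm2) lie_module_scheme \<Rightarrow> bool"
  where "lie_module_isomorphic K L U V \<longleftrightarrow>
    (\<exists>h \<in> lie_module_hom K L U V. bij_betw h (carrier U) (carrier V))"

definition pullback :: "('h \<Rightarrow> 'h) \<Rightarrow> ('a, 'h, 'v, 'm) lie_module_scheme \<Rightarrow>
    ('a, 'h, 'v, 'm) lie_module_scheme"
  where "pullback f V = V\<lparr>act := \<lambda>x. act V (f x)\<rparr>"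


section \<open>Direct limits of sequences\<close>

text \<open>The limit of \<open>X 0 \<rightarrow> X 1 \<rightarrow> X 2 \<rightarrow> \<dots>\<close>, with transition maps \<open>f k\<close> from \<open>X k\<close> to \<open>X (k + 1)\<close>,
  is the set of classes of pairs \<open>(k, x)\<close> with \<open>x \<in> X k\<close>, two pairs being identified if they become
  equal at some later stage.  Operations are computed on representatives, after moving these to a
  common stage; the unions below are unions of equal classes.\<close>

primrec advance :: "(nat \<Rightarrow> 'x \<Rightarrow> 'x) \<Rightarrow> nat \<Rightarrow> nat \<Rightarrow> 'x \<Rightarrow> 'x" where
  "advance f k 0 x = x"
| "advance f k (Suc d) x = f (k + d) (advance f k d x)"

definition transition :: "(nat \<Rightarrow> 'x \<Rightarrow> 'x) \<Rightarrow> nat \<Rightarrow> nat \<Rightarrow> 'x \<Rightarrow> 'x"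
  where "transition f k m = advance f k (m - k)"

definition lim_rel ::
    "(nat \<Rightarrow> 'x set) \<Rightarrow> (nat \<Rightarrow> 'x \<Rightarrow> 'x) \<Rightarrow> ((nat \<times> 'x) \<times> (nat \<times> 'x)) set"
  where "lim_rel X f = {((k, x), (l, y)). x \<in> X k \<and> y \<in> X l \<and>
    (\<exists>m. k \<le> m \<and> l \<le> m \<and> transition f k m x = transition f l m y)}"

definition lim_class ::
    "(nat \<Rightarrow> 'x set) \<Rightarrow> (nat \<Rightarrow> 'x \<Rightarrow> 'x) \<Rightarrow> nat \<Rightarrow> 'x \<Rightarrow> (nat \<times> 'x) set"
  where "lim_class X f k x = lim_rel X f `` {(k, x)}"

definition lim_carrier :: "(nat \<Rightarrow> 'x set) \<Rightarrow> (nat \<Rightarrow> 'x \<Rightarrow> 'x) \<Rightarrow> (nat \<times> 'x) set set"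
  where "lim_carrier X f = Sigma UNIV X // lim_rel X f"

text \<open>The operation \<open>lim X \<times> lim Y \<rightarrow> lim Y\<close> induced by operations \<open>X m \<times> Y m \<rightarrow> Y m\<close>.\<close>

definition lim_op ::
    "(nat \<Rightarrow> 'x \<Rightarrow> 'x) \<Rightarrow> (nat \<Rightarrow> 'y set) \<Rightarrow> (nat \<Rightarrow> 'y \<Rightarrow> 'y) \<Rightarrow> (nat \<Rightarrow> 'x \<Rightarrow> 'y \<Rightarrow> 'y) \<Rightarrow>
     (nat \<times> 'x) set \<Rightarrow> (nat \<times> 'y) set \<Rightarrow> (nat \<times> 'y) set"
  where "lim_op f Y g b A B =
    (\<Union>(k, x) \<in> A. \<Union>(l, y) \<in> B. let m = max k l in
       lim_class Y g m (b m (transition f k m x) (transition g l m y)))"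

definition lim_module ::
    "(nat \<Rightarrow> ('a, 'x, 'm) module_scheme) \<Rightarrow> (nat \<Rightarrow> 'x \<Rightarrow> 'x) \<Rightarrow> ('a, (nat \<times> 'x) set) module"
  where "lim_module V f = (let X = (\<lambda>k. carrier (V k)) in
    \<lparr>carrier = lim_carrier X f,
     mult = undefined,
     one = undefined,
     zero = lim_class X f 0 \<zero>\<^bsub>V 0\<^esub>,
     add = lim_op f X f (\<lambda>m. add (V m)),
     smult = (\<lambda>c A. \<Union>(k, x) \<in> A. lim_class X f k (c \<odot>\<^bsub>V k\<^esub> x))\<rparr>)"

definition lim_lie_algebra ::
    "(nat \<Rightarrow> ('a, 'g, 'l) lie_algebra_scheme) \<Rightarrow> (nat \<Rightarrow> 'g \<Rightarrow> 'g) \<Rightarrow>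
     ('a, (nat \<times> 'g) set) lie_algebra"
  where "lim_lie_algebra L f = module.extend (lim_module L f)
    (lie_algebra.fields (lim_op f (\<lambda>k. carrier (L k)) f (\<lambda>m. lie_bracket (L m))))"

text \<open>The limit of modules \<open>V k\<close> over the terms of a sequence of Lie algebras with transition
  maps \<open>f k\<close>, as a module over the limit of the Lie algebras.\<close>

definition lim_lie_module ::
    "(nat \<Rightarrow> 'g \<Rightarrow> 'g) \<Rightarrow> (nat \<Rightarrow> ('a, 'g, 'v, 'm) lie_module_scheme) \<Rightarrow> (nat \<Rightarrow> 'v \<Rightarrow> 'v) \<Rightarrow>
     ('a, (nat \<times> 'g) set, (nat \<times> 'v) set) lie_module"
  where "lim_lie_module f V \<phi> = module.extend (lim_module V \<phi>)
    (lie_module.fields (lim_op f (\<lambda>k. carrier (V k)) \<phi> (\<lambda>m. act (V m))))"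


section \<open>Natural representations of \<open>\<ss>\<ll>(n\<^sup>\<infinity>)\<close>\<close>

definition mat_trace :: "'a::comm_monoid_add mat \<Rightarrow> 'a"
  where "mat_trace A = (\<Sum>i < dim_row A. A $$ (i, i))"

definition sl :: "nat \<Rightarrow> ('a::field, 'a mat) lie_algebra"
  where "sl m = module.extend
    ((module_mat TYPE('a) m m)\<lparr>carrier := {A \<in> carrier_mat m m. mat_trace A = 0}\<rparr>)
    (lie_algebra.fields (\<lambda>A B. A * B - B * A))"

definition natural_sl :: "nat \<Rightarrow> ('a::field, 'a mat, 'a vec) lie_module"
  where "natural_sl m = module.extend (module_vec TYPE('a) m) (lie_module.fields (*\<^sub>v))"

definition diag_embed :: "nat \<Rightarrow> 'a::zero mat \<Rightarrow> 'a mat"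
  where "diag_embed n M = diag_block_mat (replicate n M)"

text \<open>Sequences are indexed from \<open>0\<close>, so that stage \<open>k\<close> is \<open>\<ss>\<ll>(n\<^bsup>k+1\<^esup>)\<close>.\<close>

definition sl_infinity :: "nat \<Rightarrow> ('a::field, (nat \<times> 'a mat) set) lie_algebra"
  where "sl_infinity n = lim_lie_algebra (\<lambda>k. sl (n ^ (k + 1))) (\<lambda>_. diag_embed n)"

definition natural_system :: "nat \<Rightarrow> (nat \<Rightarrow> 'a::field vec \<Rightarrow> 'a vec) \<Rightarrow> bool"
  where "natural_system n \<phi> \<longleftrightarrow> (\<forall>k.
    \<phi> k \<in> lie_module_hom class_ring (sl (n ^ (k + 1))) (natural_sl (n ^ (k + 1)))
            (pullback (diag_embed n) (natural_sl (n ^ (k + 2)))) \<and>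
    (\<exists>x \<in> carrier_vec (n ^ (k + 1)). \<phi> k x \<noteq> 0\<^sub>v (n ^ (k + 2))))"

definition natural_limit ::
    "nat \<Rightarrow> (nat \<Rightarrow> 'a::field vec \<Rightarrow> 'a vec) \<Rightarrow>
     ('a, (nat \<times> 'a mat) set, (nat \<times> 'a vec) set) lie_module"
  where "natural_limit n \<phi> =
    lim_lie_module (\<lambda>_. diag_embed n) (\<lambda>k. natural_sl (n ^ (k + 1))) \<phi>"

text \<open>A direct limit is determined only up to isomorphism, so every module isomorphic to the limit
  constructed above counts as one.\<close>

definition natural_representations ::
    "nat \<Rightarrow> ('a::field, (nat \<times> 'a mat) set, 'v) lie_module set"
  where "natural_representations n =
    {V. lie_module class_ring (sl_infinity n) V \<and>
        (\<exists>\<phi>. natural_system n \<phi> \<and>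
          lie_module_isomorphic class_ring (sl_infinity n) (natural_limit n \<phi>) V)}"

definition natural_iso ::
    "nat \<Rightarrow> (('a::field, (nat \<times> 'a mat) set, 'v) lie_module \<times>
             ('a, (nat \<times> 'a mat) set, 'v) lie_module) set"
  where "natural_iso n =
    {(U, V). U \<in> natural_representations n \<and> V \<in> natural_representations n \<and>
      lie_module_isomorphic class_ring (sl_infinity n) U V}"


section \<open>Tails of sequences of points\<close>

definition projective_space :: "nat \<Rightarrow> 'a::field vec set set"
  where "projective_space n = {{c \<cdot>\<^sub>v w | c. True} | w. w \<in> carrier_vec n \<and> w \<noteq> 0\<^sub>v n}"

definition point_sequences :: "nat \<Rightarrow> (nat \<Rightarrow> 'a::field vec set) set"
  where "point_sequences n = UNIV \<rightarrow> projective_space n"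

definition tail_rel ::
    "nat \<Rightarrow> ((nat \<Rightarrow> 'a::field vec set) \<times> (nat \<Rightarrow> 'a vec set)) set"
  where "tail_rel n = {(p, q). p \<in> point_sequences n \<and> q \<in> point_sequences n \<and>
    (\<forall>\<^sub>F k in sequentially. p k = q k)}"

text \<open>For \<open>w = (w\<^sub>1, \<dots>, w\<^sub>n)\<close> this is the concatenation of \<open>w\<^sub>1 x, \<dots>, w\<^sub>n x\<close>, the
  transition map attached to the line through \<open>w\<close>.\<close>

definition block_vec :: "'a::times vec \<Rightarrow> 'a vec \<Rightarrow> 'a vec"
  where "block_vec w x =
    vec (dim_vec w * dim_vec x) (\<lambda>i. w $ (i div dim_vec x) * x $ (i mod dim_vec x))"

text \<open>The isomorphism class attached to a tail \<open>T\<close>.  It collects the limits for all sequences in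
  \<open>T\<close> and all vectors spanning their points; that this is a single isomorphism class is part of
  the claim that the map takes values in the quotient by \<^const>\<open>natural_iso\<close>.\<close>

definition natural_class ::
    "nat \<Rightarrow> (nat \<Rightarrow> 'a::field vec set) set \<Rightarrow> ('a, (nat \<times> 'a mat) set, 'v) lie_module set"
  where "natural_class n T =
    {V \<in> natural_representations n. \<exists>p \<in> T. \<exists>w. (\<forall>k. w k \<in> p k - {0\<^sub>v n}) \<and>
      lie_module_isomorphic class_ring (sl_infinity n)
        (natural_limit n (\<lambda>k. block_vec (w k))) V}"

end

theory Submission
  imports Defs
begin

text \<open>A natural representation is the limit of a sequence of homomorphisms
  \<open>\<phi>\<^sub>k : F\<^sup>m \<rightarrow> F\<^sup>n\<^sup>m\<close> over \<open>\<ss>\<ll>(m)\<close>, where \<open>m = n\<^bsup>k+1\<^esup>\<close>.  Over \<open>\<ss>\<ll>(m)\<close> the target is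
  \<open>n\<close> copies of \<open>F\<^sup>m\<close>, that is, \<open>W \<otimes> F\<^sup>m\<close>, and as in Schur's lemma each such homomorphism has the form
  \<open>x \<mapsto> w \<otimes> x\<close> for a vector \<open>w\<close> of \<open>W\<close> (\<open>natural_hom_is_block_vec\<close>).  A natural representation is
  therefore given by a sequence of nonzero vectors \<open>w\<^sub>k\<close>.

  If two such sequences span the same points from some stage on, then their transition maps differ
  by nonzero scalars there, and scaling the stages by the partial products of these scalars gives an
  isomorphism of the limits (\<open>natural_limits_isomorphic\<close>).

  Conversely, let \<open>h\<close> be an isomorphism of two limits and follow one nonzero element \<open>A\<close>.  At every
  late stage, \<open>A\<close> and \<open>h A\<close> are represented by two vectors with the same annihilator in \<open>\<ss>\<ll>(m)\<close>, and
  the annihilator of a nonzero vector determines the line through it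
  (\<open>annihilator_determines_line\<close>).  So the two vectors are proportional, \<open>y\<^sub>k = c x\<^sub>k\<close>; as the same holds
  for \<open>x\<^sub>k\<^sub>+\<^sub>1 = w\<^sub>k \<otimes> x\<^sub>k\<close> and \<open>y\<^sub>k\<^sub>+\<^sub>1 = w'\<^sub>k \<otimes> y\<^sub>k\<close>, the vectors \<open>w\<^sub>k\<close> and \<open>w'\<^sub>k\<close> are
  proportional too (\<open>isomorphic_limits_same_tail\<close>).

  The remaining work is to see that the limits are modules over the limit Lie algebra.  This is
  done for limits of arbitrary systems: every axiom concerns finitely many elements, and these have
  representatives at a common stage, where the axiom holds.\<close>

section \<open>Direct limits of sequences of sets\<close>

locale sequence_system =
  fixes X :: "nat \<Rightarrow> 'x set" and f :: "nat \<Rightarrow> 'x \<Rightarrow> 'x"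
  assumes step_closed: "x \<in> X k \<Longrightarrow> f k x \<in> X (Suc k)"

lemma transition_same [simp]: "transition f k k x = x"
  by (simp add: transition_def)

lemma transition_Suc: "k \<le> m \<Longrightarrow> transition f k (Suc m) x = f m (transition f k m x)"
  by (simp add: transition_def Suc_diff_le)

lemma transition_trans:
  assumes "k \<le> l" "l \<le> m"
  shows "transition f l m (transition f k l x) = transition f k m x"
  using assms(2)
proof (induction m rule: dec_induct)
  case (step m)
  then show ?case using assms(1) by (simp add: transition_Suc)
qed simp

context sequence_system
begin

abbreviation lim_cls where "lim_cls \<equiv> lim_class X f"

lemma transition_closed:
  assumes "k \<le> m" "x \<in> X k"
  shows "transition f k m x \<in> X m"
  using assms(1)
proof (induction m rule: dec_induct)
  case (step m)
  then show ?case by (simp add: transition_Suc step_closed)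
qed (simp add: assms)

lemma lim_rel_iff:
  "((k, x), (l, y)) \<in> lim_rel X f \<longleftrightarrow> x \<in> X k \<and> y \<in> X l \<and>
    (\<exists>m. k \<le> m \<and> l \<le> m \<and> transition f k m x = transition f l m y)"
  by (simp add: lim_rel_def)

lemma equiv_lim_rel: "equiv (Sigma UNIV X) (lim_rel X f)"
proof (rule equivI)
  show "lim_rel X f \<subseteq> Sigma UNIV X \<times> Sigma UNIV X"
    by (auto simp: lim_rel_def)
  show "refl_on (Sigma UNIV X) (lim_rel X f)"
    by (auto simp: lim_rel_def intro!: refl_onI)
  show "sym (lim_rel X f)"
    by (rule symI) (clarsimp simp: lim_rel_def, metis)
  show "trans (lim_rel X f)"
  proof (rule transI)
    fix a b c assume ab: "(a, b) \<in> lim_rel X f" and bc: "(b, c) \<in> lim_rel X f"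
    obtain k x l y p z where abc: "a = (k, x)" "b = (l, y)" "c = (p, z)"
      by (metis surj_pair)
    from ab obtain m where m: "k \<le> m" "l \<le> m" "transition f k m x = transition f l m y"
      by (auto simp: abc lim_rel_iff)
    from bc obtain r where r: "l \<le> r" "p \<le> r" "transition f l r y = transition f p r z"
      by (auto simp: abc lim_rel_iff)
    have "transition f k (max m r) x = transition f l (max m r) y"
      using m by (metis max.cobounded1 transition_trans)
    also have "\<dots> = transition f p (max m r) z"
      using r by (metis max.cobounded2 transition_trans)
    finally have "transition f k (max m r) x = transition f p (max m r) z" .
    then show "(a, c) \<in> lim_rel X f"
      using ab bc m(1,2) r(1,2) by (auto simp: abc lim_rel_iff intro!: exI[of _ "max m r"])
  qed
qed

lemma lim_class_eq_iff:
  assumes "x \<in> X k" "y \<in> X l"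
  shows "lim_cls k x = lim_cls l y \<longleftrightarrow>
    (\<exists>m. k \<le> m \<and> l \<le> m \<and> transition f k m x = transition f l m y)"
  using eq_equiv_class_iff[OF equiv_lim_rel, of "(k, x)" "(l, y)"] assms
  by (simp add: lim_class_def lim_rel_iff)

lemma lim_class_transition:
  assumes "k \<le> m" "x \<in> X k"
  shows "lim_cls m (transition f k m x) = lim_cls k x"
  using assms by (auto simp: lim_class_eq_iff transition_closed)

lemma lim_class_step: "x \<in> X k \<Longrightarrow> lim_cls (Suc k) (f k x) = lim_cls k x"
  using lim_class_transition[of k "Suc k" x] by (simp add: transition_Suc)

lemma lim_class_inj:
  assumes inj: "\<And>k. inj_on (f k) (X k)"
    and xy: "x \<in> X m" "y \<in> X m" and eq: "lim_cls m x = lim_cls m y"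
  shows "x = y"
proof -
  obtain r where r: "m \<le> r" "transition f m r x = transition f m r y"
    using eq xy by (auto simp: lim_class_eq_iff)
  have "transition f m r x = transition f m r y \<longrightarrow> x = y"
    using r(1)
  proof (induction r rule: dec_induct)
    case (step r)
    then show ?case
      using xy inj_onD[OF inj[of r]] by (auto simp: transition_Suc transition_closed)
  qed simp
  then show ?thesis using r(2) by blast
qed

lemma lim_class_carrier: "x \<in> X k \<Longrightarrow> lim_cls k x \<in> lim_carrier X f"
  unfolding lim_carrier_def lim_class_def by (rule quotientI) simp

lemma in_lim_class_iff:
  "(l, y) \<in> lim_cls k x \<longleftrightarrow> x \<in> X k \<and> y \<in> X l \<and>
    (\<exists>m. k \<le> m \<and> l \<le> m \<and> transition f k m x = transition f l m y)"
  by (simp add: lim_class_def lim_rel_iff)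

lemma lim_class_nonempty: "x \<in> X k \<Longrightarrow> lim_cls k x \<noteq> {}"
  using in_lim_class_iff[of k x k x] by auto

text \<open>An element that has a representative at stage \<open>k\<close> has one at every later stage; this is
  what allows finitely many elements to be moved to one stage.\<close>

lemma lim_carrier_stages:
  assumes "A \<in> lim_carrier X f"
  obtains k where "\<And>m. k \<le> m \<Longrightarrow> \<exists>x\<in>X m. A = lim_cls m x"
proof -
  obtain k x where x: "x \<in> X k" "A = lim_cls k x"
    using assms by (auto simp: lim_carrier_def lim_class_def elim!: quotientE)
  show thesis
  proof (rule that[of k])
    fix m assume "k \<le> m"
    then show "\<exists>x\<in>X m. A = lim_cls m x"
      using x by (intro bexI[of _ "transition f k m x"])
        (simp_all add: lim_class_transition transition_closed)
  qed
qed

end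

text \<open>All identities in a limit are checked on representatives at one stage, which exists
  because only finitely many elements are involved.\<close>

lemma common_stage:
  assumes "sequence_system X f" "sequence_system Y g" "sequence_system Z h"
    and "A \<in> lim_carrier X f" "B \<in> lim_carrier Y g" "C \<in> lim_carrier Z h"
  obtains m x y z where "N \<le> m" "x \<in> X m" "A = lim_class X f m x"
    "y \<in> Y m" "B = lim_class Y g m y" "z \<in> Z m" "C = lim_class Z h m z"
proof -
  obtain a where a: "\<And>m. a \<le> m \<Longrightarrow> \<exists>x\<in>X m. A = lim_class X f m x"
    using sequence_system.lim_carrier_stages[OF assms(1,4)] by blast
  obtain b where b: "\<And>m. b \<le> m \<Longrightarrow> \<exists>y\<in>Y m. B = lim_class Y g m y"
    using sequence_system.lim_carrier_stages[OF assms(2,5)] by blast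
  obtain c where c: "\<And>m. c \<le> m \<Longrightarrow> \<exists>z\<in>Z m. C = lim_class Z h m z"
    using sequence_system.lim_carrier_stages[OF assms(3,6)] by blast
  have "N \<le> N + a + b + c" "a \<le> N + a + b + c" "b \<le> N + a + b + c" "c \<le> N + a + b + c"
    by auto
  then show thesis using a b c that by meson
qed

text \<open>An operation that commutes with the transition maps may be computed on any representatives
  that lie at a common stage.\<close>

lemma lim_op_class:
  assumes "sequence_system X f" "sequence_system Y g"
    and b_closed: "\<And>m x y. x \<in> X m \<Longrightarrow> y \<in> Y m \<Longrightarrow> b m x y \<in> Y m"
    and b_step: "\<And>m x y. x \<in> X m \<Longrightarrow> y \<in> Y m \<Longrightarrow> g m (b m x y) = b (Suc m) (f m x) (g m y)"
    and xy: "x \<in> X m" "y \<in> Y m"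
  shows "lim_op f Y g b (lim_class X f m x) (lim_class Y g m y) = lim_class Y g m (b m x y)"
proof -
  interpret X: sequence_system X f by fact
  interpret Y: sequence_system Y g by fact
  have b_transition: "transition g k l (b k x y) = b l (transition f k l x) (transition g k l y)"
    if "k \<le> l" "x \<in> X k" "y \<in> Y k" for k l x y
    using that(1)
  proof (induction l rule: dec_induct)
    case (step l)
    then show ?case
      using that by (simp add: transition_Suc b_step X.transition_closed Y.transition_closed)
  qed simp
  have rep: "lim_class Y g (max k l) (b (max k l) (transition f k (max k l) x')
      (transition g l (max k l) y')) = lim_class Y g m (b m x y)"
    if kx: "(k, x') \<in> lim_class X f m x" and ly: "(l, y') \<in> lim_class Y g m y" for k x' l y'
  proof -
    obtain r where r: "x' \<in> X k" "m \<le> r" "k \<le> r" "transition f m r x = transition f k r x'"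
      using kx by (auto simp: X.in_lim_class_iff)
    obtain s where s: "y' \<in> Y l" "m \<le> s" "l \<le> s" "transition g m s y = transition g l s y'"
      using ly by (auto simp: Y.in_lim_class_iff)
    let ?p = "max k l" and ?N = "max r s"
    have N: "?p \<le> ?N" "m \<le> ?N" "k \<le> ?N" "l \<le> ?N" using r s by auto
    have ex: "transition f k ?N x' = transition f m ?N x"
      using transition_trans[of k r ?N f x'] transition_trans[of m r ?N f x] r by simp
    have ey: "transition g l ?N y' = transition g m ?N y"
      using transition_trans[of l s ?N g y'] transition_trans[of m s ?N g y] s by simp
    let ?z = "b ?p (transition f k ?p x') (transition g l ?p y')"
    have cl: "transition f k ?p x' \<in> X ?p" "transition g l ?p y' \<in> Y ?p"
      using r s by (auto intro: X.transition_closed Y.transition_closed)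
    have "lim_class Y g ?p ?z = lim_class Y g ?N (transition g ?p ?N ?z)"
      using cl N by (simp only: Y.lim_class_transition b_closed)
    also have "transition g ?p ?N ?z = b ?N (transition f k ?N x') (transition g l ?N y')"
      using cl N by (simp add: b_transition transition_trans)
    also have "\<dots> = transition g m ?N (b m x y)"
      using N xy by (simp only: ex ey b_transition)
    also have "lim_class Y g ?N \<dots> = lim_class Y g m (b m x y)"
      using N xy by (simp only: Y.lim_class_transition b_closed)
    finally show ?thesis .
  qed
  have "(\<Union>(k, x) \<in> A. \<Union>(l, y) \<in> B. F k x l y) = C"
    if "A \<noteq> {}" "B \<noteq> {}" "\<And>k x l y. (k, x) \<in> A \<Longrightarrow> (l, y) \<in> B \<Longrightarrow> F k x l y = C"
    for A B and F :: "nat \<Rightarrow> 'a \<Rightarrow> nat \<Rightarrow> 'b \<Rightarrow> (nat \<times> 'b) set" and C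
    using that by fastforce
  then show ?thesis
    unfolding lim_op_def Let_def
    using X.lim_class_nonempty[OF xy(1)] Y.lim_class_nonempty[OF xy(2)] rep by simp
qed

section \<open>Maps of sequences\<close>

text \<open>A family of stage maps need only be defined, and commute with the transition maps, from
  stage \<open>K\<close> on: earlier representatives are first moved to stage \<open>K\<close>.\<close>

definition lim_map ::
  "nat \<Rightarrow> (nat \<Rightarrow> 'x \<Rightarrow> 'x) \<Rightarrow> (nat \<Rightarrow> 'y set) \<Rightarrow> (nat \<Rightarrow> 'y \<Rightarrow> 'y) \<Rightarrow> (nat \<Rightarrow> 'x \<Rightarrow> 'y) \<Rightarrow>
   (nat \<times> 'x) set \<Rightarrow> (nat \<times> 'y) set"
  where "lim_map K f Y g h A =
    (\<Union>(k, x) \<in> A. lim_class Y g (max k K) (h (max k K) (transition f k (max k K) x)))"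

locale sequence_map = X: sequence_system X f + Y: sequence_system Y g
  for X :: "nat \<Rightarrow> 'x set" and f and Y :: "nat \<Rightarrow> 'y set" and g +
  fixes K :: nat and h :: "nat \<Rightarrow> 'x \<Rightarrow> 'y"
  assumes map_closed: "K \<le> m \<Longrightarrow> x \<in> X m \<Longrightarrow> h m x \<in> Y m"
    and map_step: "K \<le> m \<Longrightarrow> x \<in> X m \<Longrightarrow> g m (h m x) = h (Suc m) (f m x)"
begin

lemma map_transition:
  assumes "K \<le> k" "k \<le> l" "x \<in> X k"
  shows "transition g k l (h k x) = h l (transition f k l x)"
  using assms(2)
proof (induction l rule: dec_induct)
  case (step l)
  then show ?case
    using assms by (simp add: transition_Suc map_step X.transition_closed)
qed simp

lemma lim_map_class:
  assumes "K \<le> m" "x \<in> X m"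
  shows "lim_map K f Y g h (lim_class X f m x) = lim_class Y g m (h m x)"
proof -
  have "lim_class Y g (max k K) (h (max k K) (transition f k (max k K) x')) =
      lim_class Y g m (h m x)"
    if kx: "(k, x') \<in> lim_class X f m x" for k x'
  proof -
    obtain r where r: "x' \<in> X k" "m \<le> r" "k \<le> r" "transition f m r x = transition f k r x'"
      using kx by (auto simp: X.in_lim_class_iff)
    let ?p = "max k K"
    have p: "?p \<le> r" "K \<le> ?p" "k \<le> ?p" using r assms by auto
    have cl: "transition f k ?p x' \<in> X ?p" using r by (auto intro: X.transition_closed)
    have "lim_class Y g ?p (h ?p (transition f k ?p x')) =
        lim_class Y g r (transition g ?p r (h ?p (transition f k ?p x')))"
      using cl p by (simp only: Y.lim_class_transition map_closed)
    also have "transition g ?p r (h ?p (transition f k ?p x')) = h r (transition f k r x')"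
      using cl p r by (simp only: map_transition transition_trans)
    also have "\<dots> = transition g m r (h m x)"
      using r assms by (simp only: map_transition flip: r(4))
    also have "lim_class Y g r \<dots> = lim_class Y g m (h m x)"
      using r assms by (simp only: Y.lim_class_transition map_closed)
    finally show ?thesis .
  qed
  then show ?thesis
    unfolding lim_map_def using X.lim_class_nonempty[OF assms(2)] by fastforce
qed

text \<open>Two elements with the same image have
  representatives whose images agree at some later stage, and there the stage map is injective.\<close>

lemma lim_map_bij:
  assumes bij: "\<And>m. K \<le> m \<Longrightarrow> bij_betw (h m) (X m) (Y m)"
  shows "bij_betw (lim_map K f Y g h) (lim_carrier X f) (lim_carrier Y g)"
proof (rule bij_betw_imageI)
  show "inj_on (lim_map K f Y g h) (lim_carrier X f)"
  proof (rule inj_onI)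
    fix A B assume AB: "A \<in> lim_carrier X f" "B \<in> lim_carrier X f"
      "lim_map K f Y g h A = lim_map K f Y g h B"
    obtain m x y where m: "K \<le> m" and x: "x \<in> X m" "A = lim_class X f m x"
      and y: "y \<in> X m" "B = lim_class X f m y"
      using common_stage[OF X.sequence_system_axioms X.sequence_system_axioms
          X.sequence_system_axioms AB(1,2,2)] by metis
    have "lim_class Y g m (h m x) = lim_class Y g m (h m y)"
      using AB(3) m x y by (simp add: lim_map_class)
    then obtain r where r: "m \<le> r" "transition g m r (h m x) = transition g m r (h m y)"
      using m x y by (auto simp: Y.lim_class_eq_iff map_closed)
    then have "h r (transition f m r x) = h r (transition f m r y)"
      using m x y by (simp add: map_transition)
    then have "transition f m r x = transition f m r y"
      using bij_betw_imp_inj_on[OF bij, of r] m r(1) x y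
      by (auto dest!: inj_onD intro: X.transition_closed)
    then show "A = B"
      using x y r(1) by (auto simp: X.lim_class_eq_iff)
  qed
  show "lim_map K f Y g h ` lim_carrier X f = lim_carrier Y g"
  proof (intro equalityI subsetI)
    fix B assume "B \<in> lim_map K f Y g h ` lim_carrier X f"
    then obtain A where A: "A \<in> lim_carrier X f" "B = lim_map K f Y g h A" by blast
    obtain m x where "K \<le> m" "x \<in> X m" "A = lim_class X f m x"
      using common_stage[OF X.sequence_system_axioms X.sequence_system_axioms
          X.sequence_system_axioms A(1,1,1)] by metis
    then show "B \<in> lim_carrier Y g"
      using A by (simp add: lim_map_class Y.lim_class_carrier map_closed)
  next
    fix B assume B: "B \<in> lim_carrier Y g"
    obtain m y where m: "K \<le> m" and y: "y \<in> Y m" "B = lim_class Y g m y"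
      using common_stage[OF Y.sequence_system_axioms Y.sequence_system_axioms
          Y.sequence_system_axioms B B B] by metis
    obtain x where "x \<in> X m" "y = h m x"
      using bij_betw_imp_surj_on[OF bij[OF m]] y by blast
    then show "B \<in> lim_map K f Y g h ` lim_carrier X f"
      using m y by (intro image_eqI[of _ _ "lim_class X f m x"])
        (simp_all add: lim_map_class X.lim_class_carrier)
  qed
qed

end

section \<open>Direct limits of vector spaces\<close>

text \<open>Transfers a vector space structure to records with further fields, such as a bracket or an
  action.\<close>

lemma vectorspace_cong:
  assumes V: "vectorspace K V"
    and eq: "carrier W = carrier V" "add W = add V" "zero W = zero V"
      "module.smult W = module.smult V"
  shows "vectorspace K W"
proof -
  interpret V: vectorspace K V by fact
  have "abelian_group W"
    by (rule abelian_groupI) (auto simp: eq V.M.a_ac intro: V.M.l_neg V.M.a_inv_closed)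
  moreover have "module_axioms K W"
    by (rule module_axioms.intro) (auto simp: eq V.smult_l_distr V.smult_r_distr V.smult_assoc1)
  ultimately show ?thesis
    using V by (simp add: vectorspace_def Module.module_def)
qed

lemma lim_module_simps:
  "carrier (lim_module V f) = lim_carrier (\<lambda>k. carrier (V k)) f"
  "zero (lim_module V f) = lim_class (\<lambda>k. carrier (V k)) f 0 \<zero>\<^bsub>V 0\<^esub>"
  "add (lim_module V f) =
    lim_op f (\<lambda>k. carrier (V k)) f (\<lambda>m. add (V m))"
  "module.smult (lim_module V f) =
    (\<lambda>c A. \<Union>(k, x) \<in> A. lim_class (\<lambda>k. carrier (V k)) f k (c \<odot>\<^bsub>V k\<^esub> x))"
  by (simp_all add: lim_module_def Let_def)

locale vectorspace_system =
  fixes K :: "('a, 'k) ring_scheme"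
    and V :: "nat \<Rightarrow> ('a, 'x, 'm) module_scheme" and f :: "nat \<Rightarrow> 'x \<Rightarrow> 'x"
  assumes stage_vectorspace: "vectorspace K (V k)"
    and step_hom: "f k \<in> LinearCombinations.module_hom K (V k) (V (Suc k))"
begin

abbreviation X where "X k \<equiv> carrier (V k)"

sublocale sequence_system X f
  using step_hom module_hom_closed by unfold_locales blast

sublocale stage: vectorspace K "V k" for k
  by (rule stage_vectorspace)

lemma step_add: "x \<in> X k \<Longrightarrow> y \<in> X k \<Longrightarrow> f k (x \<oplus>\<^bsub>V k\<^esub> y) = f k x \<oplus>\<^bsub>V (Suc k)\<^esub> f k y"
  by (rule LinearCombinations.module_hom_add[OF step_hom])

lemma step_smult:
  "c \<in> carrier K \<Longrightarrow> x \<in> X k \<Longrightarrow> f k (c \<odot>\<^bsub>V k\<^esub> x) = c \<odot>\<^bsub>V (Suc k)\<^esub> f k x"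
  by (rule LinearCombinations.module_hom_smult[OF step_hom])

lemma step_zero: "f k \<zero>\<^bsub>V k\<^esub> = \<zero>\<^bsub>V (Suc k)\<^esub>"
  using step_smult[of "\<zero>\<^bsub>K\<^esub>" "\<zero>\<^bsub>V k\<^esub>" k] step_closed[of "\<zero>\<^bsub>V k\<^esub>" k] by simp

abbreviation Lim where "Lim \<equiv> lim_module V f"

lemma Lim_add:
  "x \<in> X m \<Longrightarrow> y \<in> X m \<Longrightarrow> lim_cls m x \<oplus>\<^bsub>Lim\<^esub> lim_cls m y = lim_cls m (x \<oplus>\<^bsub>V m\<^esub> y)"
  unfolding lim_module_simps
  by (rule lim_op_class[OF sequence_system_axioms sequence_system_axioms])
    (simp_all add: step_add)

lemma Lim_zero: "\<zero>\<^bsub>Lim\<^esub> = lim_cls m \<zero>\<^bsub>V m\<^esub>"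
proof (induction m)
  case (Suc m)
  then show ?case using lim_class_step[of "\<zero>\<^bsub>V m\<^esub>" m] by (simp add: step_zero)
qed (simp add: lim_module_simps)

lemma Lim_smult:
  assumes c: "c \<in> carrier K" and x: "x \<in> X m"
  shows "c \<odot>\<^bsub>Lim\<^esub> lim_cls m x = lim_cls m (c \<odot>\<^bsub>V m\<^esub> x)"
proof -
  have tr: "transition f k l (c \<odot>\<^bsub>V k\<^esub> x) = c \<odot>\<^bsub>V l\<^esub> transition f k l x" if "k \<le> l" "x \<in> X k" for k l x
    using that(1)
  proof (induction l rule: dec_induct)
    case (step l)
    then show ?case using that c by (simp add: transition_Suc step_smult transition_closed)
  qed simp
  have "lim_cls k (c \<odot>\<^bsub>V k\<^esub> y) = lim_cls m (c \<odot>\<^bsub>V m\<^esub> x)" if ky: "(k, y) \<in> lim_cls m x" for k y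
  proof -
    obtain r where "y \<in> X k" "m \<le> r" "k \<le> r" "transition f m r x = transition f k r y"
      using ky by (auto simp: in_lim_class_iff)
    then show ?thesis
      using c x by (subst lim_class_eq_iff) (auto simp: tr intro!: exI[of _ r])
  qed
  then show ?thesis
    unfolding lim_module_simps using lim_class_nonempty[OF x] by fastforce
qed

lemma Lim_stage3:
  assumes "A \<in> carrier Lim" "B \<in> carrier Lim" "C \<in> carrier Lim"
  obtains m x y z where "N \<le> m" "x \<in> X m" "A = lim_cls m x" "y \<in> X m" "B = lim_cls m y"
    "z \<in> X m" "C = lim_cls m z"
  using assms common_stage[OF sequence_system_axioms sequence_system_axioms
      sequence_system_axioms, of A B C N thesis]
  by (auto simp: lim_module_simps)

lemma Lim_carrier: "x \<in> X m \<Longrightarrow> lim_cls m x \<in> carrier Lim"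
  by (simp add: lim_module_simps lim_class_carrier)

theorem vectorspace_Lim: "vectorspace K Lim"
proof -
  have "abelian_group Lim"
  proof (rule abelian_groupI)
    show "\<zero>\<^bsub>Lim\<^esub> \<in> carrier Lim"
      by (simp add: Lim_zero[of 0] Lim_carrier)
  next
    fix A B assume AB: "A \<in> carrier Lim" "B \<in> carrier Lim"
    obtain m x y where "x \<in> X m" "A = lim_cls m x" "y \<in> X m" "B = lim_cls m y"
      by (rule Lim_stage3[where N = 0, OF AB AB(2)])
    then show "A \<oplus>\<^bsub>Lim\<^esub> B \<in> carrier Lim" "A \<oplus>\<^bsub>Lim\<^esub> B = B \<oplus>\<^bsub>Lim\<^esub> A"
      by (simp_all add: Lim_add Lim_carrier stage.M.a_comm)
  next
    fix A B C assume ABC: "A \<in> carrier Lim" "B \<in> carrier Lim" "C \<in> carrier Lim"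
    obtain m x y z where "x \<in> X m" "A = lim_cls m x" "y \<in> X m" "B = lim_cls m y"
        "z \<in> X m" "C = lim_cls m z"
      by (rule Lim_stage3[where N = 0, OF ABC])
    then show "A \<oplus>\<^bsub>Lim\<^esub> B \<oplus>\<^bsub>Lim\<^esub> C = A \<oplus>\<^bsub>Lim\<^esub> (B \<oplus>\<^bsub>Lim\<^esub> C)"
      by (simp add: Lim_add stage.M.a_assoc)
  next
    fix A assume A: "A \<in> carrier Lim"
    obtain m x where x: "x \<in> X m" "A = lim_cls m x"
      by (rule Lim_stage3[where N = 0, OF A A A])
    then show "\<zero>\<^bsub>Lim\<^esub> \<oplus>\<^bsub>Lim\<^esub> A = A"
      by (simp add: Lim_add Lim_zero[of m])
    show "\<exists>B\<in>carrier Lim. B \<oplus>\<^bsub>Lim\<^esub> A = \<zero>\<^bsub>Lim\<^esub>"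
      using x by (intro bexI[of _ "lim_cls m (\<ominus>\<^bsub>V m\<^esub> x)"])
        (simp_all add: Lim_add Lim_zero[of m] Lim_carrier stage.M.l_neg)
  qed
  moreover have "module_axioms K Lim"
  proof (rule module_axioms.intro)
    fix a b A assume ab: "a \<in> carrier K" "b \<in> carrier K" and A: "A \<in> carrier Lim"
    obtain m x where x: "x \<in> X m" "A = lim_cls m x"
      by (rule Lim_stage3[where N = 0, OF A A A])
    show "(a \<oplus>\<^bsub>K\<^esub> b) \<odot>\<^bsub>Lim\<^esub> A = a \<odot>\<^bsub>Lim\<^esub> A \<oplus>\<^bsub>Lim\<^esub> b \<odot>\<^bsub>Lim\<^esub> A"
      "(a \<otimes>\<^bsub>K\<^esub> b) \<odot>\<^bsub>Lim\<^esub> A = a \<odot>\<^bsub>Lim\<^esub> (b \<odot>\<^bsub>Lim\<^esub> A)"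
      using ab x by (simp_all add: Lim_add Lim_smult stage.smult_l_distr stage.smult_assoc1)
  next
    fix A assume A: "A \<in> carrier Lim"
    obtain m x where "x \<in> X m" "A = lim_cls m x"
      by (rule Lim_stage3[where N = 0, OF A A A])
    then show "\<one>\<^bsub>K\<^esub> \<odot>\<^bsub>Lim\<^esub> A = A"
      by (simp add: Lim_smult)
  next
    fix a A assume a: "a \<in> carrier K" and A: "A \<in> carrier Lim"
    obtain m x where "x \<in> X m" "A = lim_cls m x"
      by (rule Lim_stage3[where N = 0, OF A A A])
    then show "a \<odot>\<^bsub>Lim\<^esub> A \<in> carrier Lim"
      using a by (simp add: Lim_smult Lim_carrier)
  next
    fix a A B assume a: "a \<in> carrier K" and AB: "A \<in> carrier Lim" "B \<in> carrier Lim"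
    obtain m x y where "x \<in> X m" "A = lim_cls m x" "y \<in> X m" "B = lim_cls m y"
      by (rule Lim_stage3[where N = 0, OF AB AB(2)])
    then show "a \<odot>\<^bsub>Lim\<^esub> (A \<oplus>\<^bsub>Lim\<^esub> B) = a \<odot>\<^bsub>Lim\<^esub> A \<oplus>\<^bsub>Lim\<^esub> a \<odot>\<^bsub>Lim\<^esub> B"
      using a by (simp add: Lim_smult Lim_add stage.smult_r_distr)
  qed
  ultimately show ?thesis
    using stage_vectorspace[of 0] by (simp add: vectorspace_def Module.module_def)
qed

end

section \<open>Direct limits of Lie algebras and their modules\<close>

lemma lim_lie_algebra_simps:
  "carrier (lim_lie_algebra L f) = carrier (lim_module L f)"
  "add (lim_lie_algebra L f) = add (lim_module L f)"
  "zero (lim_lie_algebra L f) = zero (lim_module L f)"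
  "module.smult (lim_lie_algebra L f) = module.smult (lim_module L f)"
  "lie_bracket (lim_lie_algebra L f) =
    lim_op f (\<lambda>k. carrier (L k)) f (\<lambda>m. lie_bracket (L m))"
  by (simp_all add: lim_lie_algebra_def module.defs lie_algebra.defs)

lemma lim_lie_module_simps:
  "carrier (lim_lie_module f V \<phi>) = carrier (lim_module V \<phi>)"
  "add (lim_lie_module f V \<phi>) = add (lim_module V \<phi>)"
  "zero (lim_lie_module f V \<phi>) = zero (lim_module V \<phi>)"
  "module.smult (lim_lie_module f V \<phi>) = module.smult (lim_module V \<phi>)"
  "act (lim_lie_module f V \<phi>) = lim_op f (\<lambda>k. carrier (V k)) \<phi> (\<lambda>m. act (V m))"
  by (simp_all add: lim_lie_module_def module.defs lie_module.defs)

locale lie_algebra_system = vectorspace_system K L f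
  for K :: "('a, 'k) ring_scheme"
    and L :: "nat \<Rightarrow> ('a, 'g, 'l) lie_algebra_scheme" and f +
  assumes stage_lie_algebra: "lie_algebra K (L k)"
    and step_bracket: "x \<in> carrier (L k) \<Longrightarrow> y \<in> carrier (L k) \<Longrightarrow>
      f k (lie_bracket (L k) x y) = lie_bracket (L (Suc k)) (f k x) (f k y)"
begin

sublocale stage: lie_algebra K "L k" for k
  by (rule stage_lie_algebra)

abbreviation LLim where "LLim \<equiv> lim_lie_algebra L f"

lemma LLim_bracket:
  "x \<in> X m \<Longrightarrow> y \<in> X m \<Longrightarrow>
    lie_bracket LLim (lim_cls m x) (lim_cls m y) = lim_cls m (lie_bracket (L m) x y)"
  unfolding lim_lie_algebra_simps
  by (rule lim_op_class[OF sequence_system_axioms sequence_system_axioms])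
    (simp_all add: step_bracket stage.bracket_closed)

theorem lie_algebra_LLim: "lie_algebra K LLim"
proof -
  interpret VL: vectorspace K LLim
    by (rule vectorspace_cong[OF vectorspace_Lim]) (simp_all add: lim_lie_algebra_simps)
  note stage_simps = lim_lie_algebra_simps(1-4) LLim_bracket Lim_add Lim_smult Lim_carrier
    stage.bracket_closed
  show ?thesis
  proof unfold_locales
    fix A B C assume ABC: "A \<in> carrier LLim" "B \<in> carrier LLim" "C \<in> carrier LLim"
    obtain m x y z where "x \<in> X m" "A = lim_cls m x" "y \<in> X m" "B = lim_cls m y"
        "z \<in> X m" "C = lim_cls m z"
      by (rule Lim_stage3[where N = 0, OF ABC[unfolded lim_lie_algebra_simps]])
    then show
      "lie_bracket LLim (A \<oplus>\<^bsub>LLim\<^esub> B) C = lie_bracket LLim A C \<oplus>\<^bsub>LLim\<^esub> lie_bracket LLim B C"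
      "lie_bracket LLim A (B \<oplus>\<^bsub>LLim\<^esub> C) = lie_bracket LLim A B \<oplus>\<^bsub>LLim\<^esub> lie_bracket LLim A C"
      "lie_bracket LLim A (lie_bracket LLim B C) \<oplus>\<^bsub>LLim\<^esub>
        lie_bracket LLim B (lie_bracket LLim C A) \<oplus>\<^bsub>LLim\<^esub>
        lie_bracket LLim C (lie_bracket LLim A B) = \<zero>\<^bsub>LLim\<^esub>"
      by (simp_all add: stage_simps stage.bracket_add_left stage.bracket_add_right
          stage.jacobi Lim_zero[of m])
  next
    fix A B assume AB: "A \<in> carrier LLim" "B \<in> carrier LLim"
    obtain m x y where "x \<in> X m" "A = lim_cls m x" "y \<in> X m" "B = lim_cls m y"
      by (rule Lim_stage3[where N = 0, OF AB[unfolded lim_lie_algebra_simps] AB(2)[unfolded lim_lie_algebra_simps]])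
    then show "lie_bracket LLim A B \<in> carrier LLim"
      by (simp add: stage_simps)
  next
    fix c A B assume c: "c \<in> carrier K" and AB: "A \<in> carrier LLim" "B \<in> carrier LLim"
    obtain m x y where "x \<in> X m" "A = lim_cls m x" "y \<in> X m" "B = lim_cls m y"
      by (rule Lim_stage3[where N = 0, OF AB[unfolded lim_lie_algebra_simps] AB(2)[unfolded lim_lie_algebra_simps]])
    then show "lie_bracket LLim (c \<odot>\<^bsub>LLim\<^esub> A) B = c \<odot>\<^bsub>LLim\<^esub> lie_bracket LLim A B"
      "lie_bracket LLim A (c \<odot>\<^bsub>LLim\<^esub> B) = c \<odot>\<^bsub>LLim\<^esub> lie_bracket LLim A B"
      using c by (simp_all add: stage_simps stage.bracket_smult_left stage.bracket_smult_right)
  next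
    fix A assume A: "A \<in> carrier LLim"
    obtain m x where "x \<in> X m" "A = lim_cls m x"
      by (rule Lim_stage3[where N = 0, OF A[unfolded lim_lie_algebra_simps] A[unfolded lim_lie_algebra_simps]
            A[unfolded lim_lie_algebra_simps]])
    then show "lie_bracket LLim A A = \<zero>\<^bsub>LLim\<^esub>"
      by (simp add: stage_simps stage.bracket_self Lim_zero[of m])
  qed
qed

end

text \<open>Writing the bracket relation of a module without subtraction spares computing inverses in
  a limit.\<close>

lemma lie_moduleI:
  assumes "lie_algebra K L" "vectorspace K V"
    and "\<And>x v. x \<in> carrier L \<Longrightarrow> v \<in> carrier V \<Longrightarrow> act V x v \<in> carrier V"
    and "\<And>x y v. x \<in> carrier L \<Longrightarrow> y \<in> carrier L \<Longrightarrow> v \<in> carrier V \<Longrightarrow>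
        act V (x \<oplus>\<^bsub>L\<^esub> y) v = act V x v \<oplus>\<^bsub>V\<^esub> act V y v"
    and "\<And>x u v. x \<in> carrier L \<Longrightarrow> u \<in> carrier V \<Longrightarrow> v \<in> carrier V \<Longrightarrow>
        act V x (u \<oplus>\<^bsub>V\<^esub> v) = act V x u \<oplus>\<^bsub>V\<^esub> act V x v"
    and "\<And>c x v. c \<in> carrier K \<Longrightarrow> x \<in> carrier L \<Longrightarrow> v \<in> carrier V \<Longrightarrow>
        act V (c \<odot>\<^bsub>L\<^esub> x) v = c \<odot>\<^bsub>V\<^esub> act V x v"
    and "\<And>c x v. c \<in> carrier K \<Longrightarrow> x \<in> carrier L \<Longrightarrow> v \<in> carrier V \<Longrightarrow>
        act V x (c \<odot>\<^bsub>V\<^esub> v) = c \<odot>\<^bsub>V\<^esub> act V x v"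
    and bracket: "\<And>x y v. x \<in> carrier L \<Longrightarrow> y \<in> carrier L \<Longrightarrow> v \<in> carrier V \<Longrightarrow>
        act V (lie_bracket L x y) v \<oplus>\<^bsub>V\<^esub> act V y (act V x v) = act V x (act V y v)"
  shows "lie_module K L V"
proof -
  interpret L: lie_algebra K L by fact
  interpret V: vectorspace K V by fact
  show ?thesis
  proof unfold_locales
    fix x y v assume xyv: "x \<in> carrier L" "y \<in> carrier L" "v \<in> carrier V"
    let ?a = "act V (lie_bracket L x y) v" and ?b = "act V y (act V x v)"
    have cl: "?a \<in> carrier V" "?b \<in> carrier V"
      using xyv by (simp_all add: assms(3) L.bracket_closed)
    have "act V x (act V y v) \<ominus>\<^bsub>V\<^esub> ?b = ?a \<oplus>\<^bsub>V\<^esub> ?b \<ominus>\<^bsub>V\<^esub> ?b"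
      using bracket[OF xyv] by (rule arg_cong[symmetric])
    also have "\<dots> = ?a"
      using cl by (simp add: a_minus_def V.M.a_assoc V.M.r_neg)
    finally show "?a = act V x (act V y v) \<ominus>\<^bsub>V\<^esub> ?b" by (rule sym)
  qed (fact assms)+
qed

lemma (in lie_module) act_bracket_add:
  assumes "x \<in> carrier L" "y \<in> carrier L" "v \<in> carrier V"
  shows "act V (lie_bracket L x y) v \<oplus>\<^bsub>V\<^esub> act V y (act V x v) = act V x (act V y v)"
  using assms by (simp add: act_bracket act_closed V.M.a_assoc V.M.l_neg a_minus_def)

locale lie_module_system = L: lie_algebra_system K L f + V: vectorspace_system K V \<phi>
  for K :: "('a, 'k) ring_scheme"
    and L :: "nat \<Rightarrow> ('a, 'g, 'l) lie_algebra_scheme" and f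
    and V :: "nat \<Rightarrow> ('a, 'g, 'v, 'm) lie_module_scheme" and \<phi> +
  assumes stage_lie_module: "lie_module K (L k) (V k)"
    and step_act: "x \<in> carrier (L k) \<Longrightarrow> v \<in> carrier (V k) \<Longrightarrow>
      \<phi> k (act (V k) x v) = act (V (Suc k)) (f k x) (\<phi> k v)"
begin

sublocale stage: lie_module K "L k" "V k" for k
  by (rule stage_lie_module)

abbreviation VLim where "VLim \<equiv> lim_lie_module f V \<phi>"

lemma VLim_act:
  "x \<in> L.X m \<Longrightarrow> v \<in> V.X m \<Longrightarrow>
    act VLim (L.lim_cls m x) (V.lim_cls m v) = V.lim_cls m (act (V m) x v)"
  unfolding lim_lie_module_simps
  by (rule lim_op_class[OF L.sequence_system_axioms V.sequence_system_axioms])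
    (simp_all add: step_act stage.act_closed)

lemma LV_stage:
  assumes "A \<in> carrier L.LLim" "B \<in> carrier L.LLim" "U \<in> carrier VLim"
  obtains m x y u where "x \<in> L.X m" "A = L.lim_cls m x" "y \<in> L.X m" "B = L.lim_cls m y"
    "u \<in> V.X m" "U = V.lim_cls m u"
  using assms common_stage[OF L.sequence_system_axioms L.sequence_system_axioms
      V.sequence_system_axioms, of A B U 0 thesis]
  by (auto simp: lim_module_simps lim_lie_algebra_simps lim_lie_module_simps)

lemma LVV_stage:
  assumes "A \<in> carrier L.LLim" "U \<in> carrier VLim" "W \<in> carrier VLim"
  obtains m x u w where "N \<le> m" "x \<in> L.X m" "A = L.lim_cls m x" "u \<in> V.X m" "U = V.lim_cls m u"
    "w \<in> V.X m" "W = V.lim_cls m w"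
  using assms common_stage[OF L.sequence_system_axioms V.sequence_system_axioms
      V.sequence_system_axioms, of A U W N thesis]
  by (auto simp: lim_module_simps lim_lie_algebra_simps lim_lie_module_simps)

theorem lie_module_VLim: "lie_module K L.LLim VLim"
proof (rule lie_moduleI)
  show "lie_algebra K L.LLim" by (rule L.lie_algebra_LLim)
  show "vectorspace K VLim"
    by (rule vectorspace_cong[OF V.vectorspace_Lim]) (simp_all add: lim_lie_module_simps)
  note stage_simps = lim_lie_algebra_simps(1-4) lim_lie_module_simps(1-4) L.LLim_bracket VLim_act
    L.Lim_add L.Lim_smult V.Lim_add V.Lim_smult V.Lim_carrier
    stage.act_closed L.stage.bracket_closed
  {
    fix A B U assume ABU: "A \<in> carrier L.LLim" "B \<in> carrier L.LLim" "U \<in> carrier VLim"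
    obtain m x y u where "x \<in> L.X m" "A = L.lim_cls m x" "y \<in> L.X m" "B = L.lim_cls m y"
        "u \<in> V.X m" "U = V.lim_cls m u"
      by (rule LV_stage[OF ABU])
    then show "act VLim (A \<oplus>\<^bsub>L.LLim\<^esub> B) U = act VLim A U \<oplus>\<^bsub>VLim\<^esub> act VLim B U"
      "act VLim (lie_bracket L.LLim A B) U \<oplus>\<^bsub>VLim\<^esub> act VLim B (act VLim A U) =
        act VLim A (act VLim B U)"
      by (simp_all add: stage_simps stage.act_add_left stage.act_bracket_add)
  next
    fix A U W assume AUW: "A \<in> carrier L.LLim" "U \<in> carrier VLim" "W \<in> carrier VLim"
    obtain m x u w where "x \<in> L.X m" "A = L.lim_cls m x" "u \<in> V.X m" "U = V.lim_cls m u"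
        "w \<in> V.X m" "W = V.lim_cls m w"
      by (rule LVV_stage[where N = 0, OF AUW])
    then show "act VLim A (U \<oplus>\<^bsub>VLim\<^esub> W) = act VLim A U \<oplus>\<^bsub>VLim\<^esub> act VLim A W"
      by (simp add: stage_simps stage.act_add_right)
  next
    fix A U assume AU: "A \<in> carrier L.LLim" "U \<in> carrier VLim"
    obtain m x u where "x \<in> L.X m" "A = L.lim_cls m x" "u \<in> V.X m" "U = V.lim_cls m u"
      by (rule LVV_stage[where N = 0, OF AU AU(2)])
    then show "act VLim A U \<in> carrier VLim"
      by (simp add: stage_simps)
  next
    fix c A U assume c: "c \<in> carrier K" and AU: "A \<in> carrier L.LLim" "U \<in> carrier VLim"
    obtain m x u where "x \<in> L.X m" "A = L.lim_cls m x" "u \<in> V.X m" "U = V.lim_cls m u"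
      by (rule LVV_stage[where N = 0, OF AU AU(2)])
    then show "act VLim (c \<odot>\<^bsub>L.LLim\<^esub> A) U = c \<odot>\<^bsub>VLim\<^esub> act VLim A U"
      "act VLim A (c \<odot>\<^bsub>VLim\<^esub> U) = c \<odot>\<^bsub>VLim\<^esub> act VLim A U"
      using c by (simp_all add: stage_simps stage.act_smult_left stage.act_smult_right)
  }
qed

end

text \<open>Isomorphisms of the stages that commute with the transition maps from some stage on induce
  an isomorphism of the limits.  So a limit depends only on the tail of its
  system.\<close>

lemma lim_lie_module_isomorphic:
  assumes V: "lie_module_system K L f V \<phi>" and W: "lie_module_system K L f W \<psi>"
    and hom: "\<And>m. N \<le> m \<Longrightarrow> h m \<in> lie_module_hom K (L m) (V m) (W m)"
    and bij: "\<And>m. N \<le> m \<Longrightarrow> bij_betw (h m) (carrier (V m)) (carrier (W m))"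
    and comm: "\<And>m v. N \<le> m \<Longrightarrow> v \<in> carrier (V m) \<Longrightarrow> \<psi> m (h m v) = h (Suc m) (\<phi> m v)"
  shows "lie_module_isomorphic K (lim_lie_algebra L f)
    (lim_lie_module f V \<phi>) (lim_lie_module f W \<psi>)"
proof -
  interpret V: lie_module_system K L f V \<phi> by fact
  interpret W: lie_module_system K L f W \<psi> by fact
  interpret sequence_map V.V.X \<phi> W.V.X \<psi> N h
  proof (rule sequence_map.intro[OF V.V.sequence_system_axioms W.V.sequence_system_axioms],
      rule sequence_map_axioms.intro)
    show "h m x \<in> W.V.X m" if "N \<le> m" "x \<in> V.V.X m" for m x
      using bij_betwE[OF bij[OF that(1)]] that(2) by blast
    show "\<psi> m (h m x) = h (Suc m) (\<phi> m x)" if "N \<le> m" "x \<in> V.V.X m" for m x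
      using that by (rule comm)
  qed
  let ?h = "lim_map N \<phi> W.V.X \<psi> h"
  have mhom: "h m \<in> LinearCombinations.module_hom K (V m) (W m)" if "N \<le> m" for m
    using hom[OF that] by (simp add: lie_module_hom_def)
  have hact: "h m (act (V m) x u) = act (W m) x (h m u)"
    if "N \<le> m" "x \<in> carrier (L m)" "u \<in> carrier (V m)" for m x u
    using hom[OF that(1)] that by (simp add: lie_module_hom_def)
  note stage_simps = lim_lie_module_simps(1-4) lim_map_class V.VLim_act W.VLim_act
    V.V.Lim_add V.V.Lim_smult W.V.Lim_add W.V.Lim_smult W.V.Lim_carrier
    V.stage.act_closed map_closed hact
  have "?h \<in> LinearCombinations.module_hom K V.VLim W.VLim"
    unfolding LinearCombinations.module_hom_def
  proof (clarify, intro conjI Pi_I allI impI; (elim conjE)?)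
    fix A assume "A \<in> carrier V.VLim"
    then have A: "A \<in> carrier V.V.Lim" by (simp add: lim_lie_module_simps)
    obtain m x where "N \<le> m" "x \<in> V.V.X m" "A = V.V.lim_cls m x"
      by (rule V.V.Lim_stage3[where N = N, OF A A A])
    then show "?h A \<in> carrier W.VLim"
      by (simp add: stage_simps)
  next
    fix A B assume "A \<in> carrier V.VLim" "B \<in> carrier V.VLim"
    then have AB: "A \<in> carrier V.V.Lim" "B \<in> carrier V.V.Lim"
      by (simp_all add: lim_lie_module_simps)
    obtain m x y where "N \<le> m" "x \<in> V.V.X m" "A = V.V.lim_cls m x"
        "y \<in> V.V.X m" "B = V.V.lim_cls m y"
      by (rule V.V.Lim_stage3[where N = N, OF AB AB(2)])
    then show "?h (A \<oplus>\<^bsub>V.VLim\<^esub> B) = ?h A \<oplus>\<^bsub>W.VLim\<^esub> ?h B"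
      by (simp add: stage_simps LinearCombinations.module_hom_add[OF mhom])
  next
    fix c A assume c: "c \<in> carrier K" and "A \<in> carrier V.VLim"
    then have A: "A \<in> carrier V.V.Lim" by (simp add: lim_lie_module_simps)
    obtain m x where "N \<le> m" "x \<in> V.V.X m" "A = V.V.lim_cls m x"
      by (rule V.V.Lim_stage3[where N = N, OF A A A])
    then show "?h (c \<odot>\<^bsub>V.VLim\<^esub> A) = c \<odot>\<^bsub>W.VLim\<^esub> ?h A"
      using c by (simp add: stage_simps LinearCombinations.module_hom_smult[OF mhom])
  qed
  moreover have "?h (act V.VLim A U) = act W.VLim A (?h U)"
    if AU: "A \<in> carrier V.L.LLim" "U \<in> carrier V.VLim" for A U
  proof -
    obtain m x u where "N \<le> m" "x \<in> V.L.X m" "A = V.L.lim_cls m x"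
        "u \<in> V.V.X m" "U = V.V.lim_cls m u"
      by (rule V.LVV_stage[where N = N, OF AU AU(2)])
    then show ?thesis
      by (simp add: stage_simps)
  qed
  moreover have "bij_betw ?h (carrier V.VLim) (carrier W.VLim)"
    using lim_map_bij[OF bij] by (simp add: lim_lie_module_simps lim_module_simps)
  ultimately show ?thesis
    unfolding lie_module_isomorphic_def lie_module_hom_def by blast
qed


section \<open>Isomorphism of modules is an equivalence relation\<close>

lemma lie_module_homD:
  assumes "h \<in> lie_module_hom K L U V"
  shows "u \<in> carrier U \<Longrightarrow> h u \<in> carrier V"
    and "u \<in> carrier U \<Longrightarrow> v \<in> carrier U \<Longrightarrow> h (u \<oplus>\<^bsub>U\<^esub> v) = h u \<oplus>\<^bsub>V\<^esub> h v"
    and "c \<in> carrier K \<Longrightarrow> u \<in> carrier U \<Longrightarrow> h (c \<odot>\<^bsub>U\<^esub> u) = c \<odot>\<^bsub>V\<^esub> h u"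
    and "x \<in> carrier L \<Longrightarrow> u \<in> carrier U \<Longrightarrow> h (act U x u) = act V x (h u)"
  using assms by (auto simp: lie_module_hom_def LinearCombinations.module_hom_def)

lemma lie_module_homI:
  assumes "\<And>u. u \<in> carrier U \<Longrightarrow> h u \<in> carrier V"
    and "\<And>u v. u \<in> carrier U \<Longrightarrow> v \<in> carrier U \<Longrightarrow> h (u \<oplus>\<^bsub>U\<^esub> v) = h u \<oplus>\<^bsub>V\<^esub> h v"
    and "\<And>c u. c \<in> carrier K \<Longrightarrow> u \<in> carrier U \<Longrightarrow> h (c \<odot>\<^bsub>U\<^esub> u) = c \<odot>\<^bsub>V\<^esub> h u"
    and "\<And>x u. x \<in> carrier L \<Longrightarrow> u \<in> carrier U \<Longrightarrow> h (act U x u) = act V x (h u)"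
  shows "h \<in> lie_module_hom K L U V"
  using assms by (auto simp: lie_module_hom_def LinearCombinations.module_hom_def)

lemma lie_module_isomorphic_refl: "lie_module_isomorphic K L V V"
  unfolding lie_module_isomorphic_def
  by (rule bexI[of _ "\<lambda>v. v"]) (auto intro: lie_module_homI simp: bij_betw_def inj_on_def)

lemma lie_module_isomorphic_trans:
  assumes "lie_module_isomorphic K L U V" "lie_module_isomorphic K L V W"
  shows "lie_module_isomorphic K L U W"
proof -
  obtain g where g: "g \<in> lie_module_hom K L U V" "bij_betw g (carrier U) (carrier V)"
    using assms(1) by (auto simp: lie_module_isomorphic_def)
  obtain h where h: "h \<in> lie_module_hom K L V W" "bij_betw h (carrier V) (carrier W)"
    using assms(2) by (auto simp: lie_module_isomorphic_def)
  have "h \<circ> g \<in> lie_module_hom K L U W"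
    by (rule lie_module_homI) (simp_all add: lie_module_homD[OF g(1)] lie_module_homD[OF h(1)])
  then show ?thesis
    using bij_betw_trans[OF g(2) h(2)] by (auto simp: lie_module_isomorphic_def)
qed

text \<open>The inverse of a bijective homomorphism is a homomorphism because \<open>U\<close> is closed under its
  operations: both sides of each law lie in \<open>U\<close> and have the same image.\<close>

lemma lie_module_isomorphic_sym:
  assumes U: "lie_module K L U" and iso: "lie_module_isomorphic K L U V"
  shows "lie_module_isomorphic K L V U"
proof -
  interpret U: lie_module K L U by fact
  obtain h where h: "h \<in> lie_module_hom K L U V" "bij_betw h (carrier U) (carrier V)"
    using iso by (auto simp: lie_module_isomorphic_def)
  define g where "g = the_inv_into (carrier U) h"
  have bij: "bij_betw g (carrier V) (carrier U)"
    unfolding g_def by (rule bij_betw_the_inv_into[OF h(2)])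
  have g: "g v \<in> carrier U" "h (g v) = v" if "v \<in> carrier V" for v
    using bij_betwE[OF bij] f_the_inv_into_f_bij_betw[OF h(2)] that by (auto simp: g_def)
  have g_eqI: "g v = u" if "h u = v" "u \<in> carrier U" for u v
    using the_inv_into_f_eq[OF bij_betw_imp_inj_on[OF h(2)] that] by (simp add: g_def)
  have "g \<in> lie_module_hom K L V U"
    by (rule lie_module_homI; (rule g_eqI)?)
      (simp_all add: g lie_module_homD[OF h(1)] U.act_closed)
  then show ?thesis
    using bij by (auto simp: lie_module_isomorphic_def)
qed

section \<open>Block diagonal embeddings and block vectors\<close>

lemma div_less_of_mult: "i < n * m \<Longrightarrow> i div m < (n :: nat)"
  by (simp add: less_mult_imp_div_less)

lemma mod_less_of_mult: "i < n * m \<Longrightarrow> i mod m < (m :: nat)"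
  by (cases "m = 0") auto

lemma block_index_less:
  assumes "b < n" "j < m"
  shows "b * m + j < n * (m :: nat)"
proof -
  have "b * m + j < Suc b * m" using assms(2) by simp
  also have "\<dots> \<le> n * m" using assms(1) by (intro mult_le_mono1) simp
  finally show ?thesis .
qed

text \<open>Row \<open>i\<close> of a block diagonal matrix is supported on the block \<open>i div m\<close>, so that products with
  such a matrix are sums over this one block.\<close>

lemma sum_over_block:
  fixes F :: "nat \<Rightarrow> 'a::comm_monoid_add"
  assumes "b < n"
  shows "(\<Sum>k<n * m. if b = k div m then F k else 0) = (\<Sum>j<m. F (b * m + j))"
proof -
  have "(\<Sum>k<n * m. if b = k div m then F k else 0) = sum F {k \<in> {..<n * m}. b = k div m}"
    by (rule sum.inter_filter[symmetric]) simp
  also have "{k \<in> {..<n * m}. b = k div m} = (\<lambda>j. b * m + j) ` {..<m}"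
  proof (intro equalityI subsetI)
    fix k assume "k \<in> {k \<in> {..<n * m}. b = k div m}"
    then show "k \<in> (\<lambda>j. b * m + j) ` {..<m}"
      by (intro image_eqI[of _ _ "k mod m"]) (auto dest: mod_less_of_mult)
  qed (use block_index_less[OF assms] in auto)
  finally show ?thesis
    by (simp add: sum.reindex)
qed

lemma diag_embed_Suc:
  assumes "M \<in> carrier_mat m m"
  shows "diag_embed (Suc n) M =
    four_block_mat M (0\<^sub>m m (n * m)) (0\<^sub>m (n * m) m) (diag_embed n M)"
  using assms by (simp add: diag_embed_def Let_def dim_diag_block_mat sum_list_replicate)

lemma diag_embed_carrier: "M \<in> carrier_mat m m \<Longrightarrow> diag_embed n M \<in> carrier_mat (n * m) (n * m)"
  by (rule carrier_matI) (auto simp: diag_embed_def dim_diag_block_mat sum_list_replicate)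

lemma diag_embed_index:
  assumes M: "M \<in> carrier_mat m m"
  shows "i < n * m \<Longrightarrow> j < n * m \<Longrightarrow>
    diag_embed n M $$ (i, j) = (if i div m = j div m then M $$ (i mod m, j mod m) else 0)"
proof (induction n arbitrary: i j)
  case (Suc n)
  have "0 < m" using Suc.prems by (cases m) auto
  have later: "k div m = Suc ((k - m) div m)" "k mod m = (k - m) mod m" if "\<not> k < m" for k
    using \<open>0 < m\<close> that by (simp_all add: div_if mod_if)
  show ?case
    using Suc.prems M diag_embed_carrier[OF M, of n] \<open>0 < m\<close>
    by (auto simp: diag_embed_Suc[OF M] later Suc.IH)
qed simp

lemma mult_mat_index_sum:
  assumes "A \<in> carrier_mat p q" "B \<in> carrier_mat q r" "i < p" "j < r"
  shows "(A * B) $$ (i, j) = (\<Sum>k<q. A $$ (i, k) * B $$ (k, j))"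
  using assms by (auto simp: scalar_prod_def atLeast0LessThan intro!: sum.cong)

lemma mult_mat_vec_index_sum:
  assumes "A \<in> carrier_mat p q" "v \<in> carrier_vec q" "i < p"
  shows "(A *\<^sub>v v) $ i = (\<Sum>k<q. A $$ (i, k) * v $ k)"
  using assms by (auto simp: scalar_prod_def atLeast0LessThan intro!: sum.cong)

lemma smult_mat_mult_vec:
  fixes A :: "'a::comm_semiring_0 mat"
  assumes "A \<in> carrier_mat p q" "v \<in> carrier_vec q"
  shows "(c \<cdot>\<^sub>m A) *\<^sub>v v = c \<cdot>\<^sub>v (A *\<^sub>v v)"
  using assms
  by (intro eq_vecI) (auto simp: scalar_prod_def sum_distrib_left mult.assoc)

lemma diag_embed_add:
  assumes "A \<in> carrier_mat m m" "B \<in> carrier_mat m m"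
  shows "diag_embed n (A + B) = diag_embed n A + diag_embed n (B :: 'a::monoid_add mat)"
  using assms diag_embed_carrier[OF assms(1), of n] diag_embed_carrier[OF assms(2), of n]
    diag_embed_carrier[of "A + B" m n]
  by (intro eq_matI) (auto simp: diag_embed_index[of _ m] mod_less_of_mult)

lemma diag_embed_minus:
  assumes "A \<in> carrier_mat m m" "B \<in> carrier_mat m m"
  shows "diag_embed n (A - B) = diag_embed n A - diag_embed n (B :: 'a::group_add mat)"
  using assms diag_embed_carrier[OF assms(1), of n] diag_embed_carrier[OF assms(2), of n]
    diag_embed_carrier[of "A - B" m n]
  by (intro eq_matI) (auto simp: diag_embed_index[of _ m] mod_less_of_mult minus_carrier_mat)

lemma diag_embed_smult:
  assumes "A \<in> carrier_mat m m"
  shows "diag_embed n (c \<cdot>\<^sub>m A) = c \<cdot>\<^sub>m diag_embed n (A :: 'a::mult_zero mat)"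
  using assms diag_embed_carrier[OF assms(1), of n] diag_embed_carrier[of "c \<cdot>\<^sub>m A" m n]
  by (intro eq_matI) (auto simp: diag_embed_index[of _ m] mod_less_of_mult)

lemma diag_embed_mult:
  fixes A B :: "'a::semiring_0 mat"
  assumes A: "A \<in> carrier_mat m m" and B: "B \<in> carrier_mat m m"
  shows "diag_embed n (A * B) = diag_embed n A * diag_embed n B"
proof (rule eq_matI)
  note cA = diag_embed_carrier[OF A, of n] and cB = diag_embed_carrier[OF B, of n]
    and cAB = diag_embed_carrier[of "A * B" m n]
  fix i j assume "i < dim_row (diag_embed n A * diag_embed n B)"
    "j < dim_col (diag_embed n A * diag_embed n B)"
  then have ij: "i < n * m" "j < n * m" using cA cB by auto
  have "(diag_embed n A * diag_embed n B) $$ (i, j) =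
      (\<Sum>k<n * m. if i div m = k div m then A $$ (i mod m, k mod m) *
        (if k div m = j div m then B $$ (k mod m, j mod m) else 0) else 0)"
    using ij by (subst mult_mat_index_sum[OF cA cB])
      (auto simp: diag_embed_index[OF A] diag_embed_index[OF B] intro!: sum.cong)
  also have "\<dots> = (\<Sum>l<m. A $$ (i mod m, l) *
      (if i div m = j div m then B $$ (l, j mod m) else 0))"
    by (subst sum_over_block[OF div_less_of_mult[OF ij(1)]]) (auto intro!: sum.cong)
  also have "\<dots> = diag_embed n (A * B) $$ (i, j)"
    using ij A B mod_less_of_mult[OF ij(1)] mod_less_of_mult[OF ij(2)]
    by (simp add: diag_embed_index[of _ m] mult_mat_index_sum[OF A B] del: index_mult_mat(1))
  finally show "diag_embed n (A * B) $$ (i, j) = (diag_embed n A * diag_embed n B) $$ (i, j)"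
    by (rule sym)
qed (use diag_embed_carrier[OF A, of n] diag_embed_carrier[OF B, of n]
    diag_embed_carrier[of "A * B" m n] A B in auto)

lemma diag_embed_mult_vec_index:
  fixes A :: "'a::semiring_0 mat"
  assumes A: "A \<in> carrier_mat m m" and u: "u \<in> carrier_vec (n * m)" and i: "i < n * m"
  shows "(diag_embed n A *\<^sub>v u) $ i = (\<Sum>l<m. A $$ (i mod m, l) * u $ (i div m * m + l))"
proof -
  have "(diag_embed n A *\<^sub>v u) $ i =
      (\<Sum>k<n * m. if i div m = k div m then A $$ (i mod m, k mod m) * u $ k else 0)"
    using i by (subst mult_mat_vec_index_sum[OF diag_embed_carrier[OF A] u])
      (auto simp: diag_embed_index[OF A] intro!: sum.cong)
  then show ?thesis
    by (subst (asm) sum_over_block[OF div_less_of_mult[OF i]]) (auto intro!: sum.cong)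
qed

lemma mat_trace_diag_embed:
  assumes M: "M \<in> carrier_mat m m"
  shows "mat_trace (diag_embed n M) = (\<Sum>b<n. mat_trace (M :: 'a::comm_monoid_add mat))"
proof -
  have "mat_trace (diag_embed n M) = (\<Sum>i<n * m. M $$ (i mod m, i mod m))"
    using diag_embed_carrier[OF M, of n] M
    by (auto simp: mat_trace_def diag_embed_index intro!: sum.cong)
  also have "\<dots> = (\<Sum>b<n. \<Sum>i\<in>{b * m..<b * m + m}. M $$ (i mod m, i mod m))"
    by (rule sum.nat_group[symmetric])
  also have "\<dots> = (\<Sum>b<n. \<Sum>j<m. M $$ (j, j))"
  proof (rule sum.cong[OF refl])
    fix b
    have "(\<Sum>i\<in>{b * m..<b * m + m}. M $$ (i mod m, i mod m)) =
        (\<Sum>i\<in>{0 + b * m..<m + b * m}. M $$ (i mod m, i mod m))"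
      by (simp add: add.commute)
    also have "\<dots> = (\<Sum>j\<in>{0..<m}. M $$ ((j + b * m) mod m, (j + b * m) mod m))"
      by (rule sum.shift_bounds_nat_ivl)
    finally show "(\<Sum>i\<in>{b * m..<b * m + m}. M $$ (i mod m, i mod m)) = (\<Sum>j<m. M $$ (j, j))"
      by (simp add: atLeast0LessThan)
  qed
  finally show ?thesis
    using M by (simp add: mat_trace_def)
qed

lemma block_vec_carrier:
  "w \<in> carrier_vec n \<Longrightarrow> x \<in> carrier_vec m \<Longrightarrow> block_vec w x \<in> carrier_vec (n * m)"
  by (auto simp: block_vec_def)

lemma block_vec_index:
  assumes "w \<in> carrier_vec n" "x \<in> carrier_vec m" "i < n * m"
  shows "block_vec w x $ i = w $ (i div m) * x $ (i mod m)"
  using assms by (auto simp: block_vec_def)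

text \<open>Each block of \<open>block_vec w x\<close> is a multiple of \<open>x\<close>, and a block diagonal matrix acts on each
  block by the same matrix.  Hence block vectors give homomorphisms.\<close>

lemma diag_embed_mult_block_vec:
  fixes A :: "'a::comm_ring_1 mat"
  assumes A: "A \<in> carrier_mat m m" and w: "w \<in> carrier_vec n" and x: "x \<in> carrier_vec m"
  shows "diag_embed n A *\<^sub>v block_vec w x = block_vec w (A *\<^sub>v x)"
proof (rule eq_vecI)
  have Ax: "A *\<^sub>v x \<in> carrier_vec m" using A x by simp
  fix i assume "i < dim_vec (block_vec w (A *\<^sub>v x))"
  then have i: "i < n * m" using block_vec_carrier[OF w Ax] by simp
  have less: "i div m * m + l < n * m" if "l < m" for l
    using block_index_less[OF div_less_of_mult[OF i] that] .
  have "(diag_embed n A *\<^sub>v block_vec w x) $ i =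
      (\<Sum>l<m. A $$ (i mod m, l) * (w $ (i div m) * x $ l))"
    using i by (subst diag_embed_mult_vec_index[OF A block_vec_carrier[OF w x]])
      (auto simp: block_vec_index[OF w x] less intro!: sum.cong)
  also have "\<dots> = w $ (i div m) * (A *\<^sub>v x) $ (i mod m)"
    by (subst mult_mat_vec_index_sum[OF A x mod_less_of_mult[OF i]])
      (simp add: sum_distrib_left mult_ac)
  finally show "(diag_embed n A *\<^sub>v block_vec w x) $ i = block_vec w (A *\<^sub>v x) $ i"
    by (simp only: block_vec_index[OF w Ax i])
qed (use diag_embed_carrier[OF A, of n] block_vec_carrier[OF w, of "A *\<^sub>v x" m] A x in auto)

lemma block_vec_add:
  assumes "w \<in> carrier_vec n" "x \<in> carrier_vec m" "y \<in> carrier_vec m"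
  shows "block_vec w (x + y) = block_vec w x + block_vec w (y :: 'a::semiring vec)"
  using assms by (intro eq_vecI) (auto simp: block_vec_def mod_less_of_mult distrib_left)

lemma block_vec_smult_right: "block_vec w (c \<cdot>\<^sub>v x) = c \<cdot>\<^sub>v block_vec w (x :: 'a::comm_semiring_1 vec)"
  by (intro eq_vecI) (auto simp: block_vec_def mod_less_of_mult mult_ac)

lemma block_vec_smult_left: "block_vec (c \<cdot>\<^sub>v w) x = c \<cdot>\<^sub>v block_vec w (x :: 'a::comm_semiring_1 vec)"
  by (intro eq_vecI) (auto simp: block_vec_def div_less_of_mult mult_ac)

text \<open>A block vector is a pure tensor: a nonzero entry of one factor allows the other to be read
  off.  Cancelling \<open>x\<close> recovers the transition vector from one value, and cancelling \<open>w\<close> says that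
  the transition maps are injective.\<close>

lemma block_vec_left_cancel:
  fixes w w' :: "'a::field vec"
  assumes w: "w \<in> carrier_vec n" "w' \<in> carrier_vec n" and x: "x \<in> carrier_vec m" "x \<noteq> 0\<^sub>v m"
    and eq: "block_vec w x = block_vec w' x"
  shows "w = w'"
proof (rule eq_vecI)
  obtain j where j: "j < m" "x $ j \<noteq> 0"
    using x by (metis eq_vecI carrier_vecD dim_vec index_zero_vec(1,2))
  fix b assume "b < dim_vec w'"
  then have b: "b < n" using w by simp
  have "block_vec w x $ (b * m + j) = block_vec w' x $ (b * m + j)"
    using eq by simp
  then show "w $ b = w' $ b"
    using j block_index_less[OF b j(1)]
    by (simp add: block_vec_index[OF w(1) x(1)] block_vec_index[OF w(2) x(1)])
qed (use w in auto)

lemma block_vec_right_cancel: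
  fixes w x y :: "'a::field vec"
  assumes w: "w \<in> carrier_vec n" "w \<noteq> 0\<^sub>v n" and x: "x \<in> carrier_vec m" "y \<in> carrier_vec m"
    and eq: "block_vec w x = block_vec w y"
  shows "x = y"
proof (rule eq_vecI)
  obtain b where b: "b < n" "w $ b \<noteq> 0"
    using w by (metis eq_vecI carrier_vecD dim_vec index_zero_vec(1,2))
  fix j assume "j < dim_vec y"
  then have j: "j < m" using x by simp
  have "block_vec w x $ (b * m + j) = block_vec w y $ (b * m + j)"
    using eq by simp
  then show "x $ j = y $ j"
    using b j block_index_less[OF b(1) j]
    by (simp add: block_vec_index[OF w(1) x(1)] block_vec_index[OF w(1) x(2)])
qed (use x in auto)

section \<open>The Lie algebras of traceless matrices and their natural modules\<close>

lemma sl_simps: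
  "carrier (sl m) = {A \<in> carrier_mat m m. mat_trace A = 0}"
  "add (sl m) = (+)"
  "zero (sl m) = 0\<^sub>m m m"
  "module.smult (sl m) = (\<cdot>\<^sub>m)"
  "lie_bracket (sl m) = (\<lambda>A B. A * B - B * A)"
  by (simp_all add: sl_def module.defs lie_algebra.defs module_mat_def)

lemma natural_sl_simps:
  "carrier (natural_sl m) = carrier_vec m"
  "add (natural_sl m) = (+)"
  "zero (natural_sl m) = 0\<^sub>v m"
  "module.smult (natural_sl m) = (\<cdot>\<^sub>v)"
  "act (natural_sl m) = (*\<^sub>v)"
  by (simp_all add: natural_sl_def module.defs lie_module.defs module_vec_def)

lemma mat_trace_add:
  "A \<in> carrier_mat m m \<Longrightarrow> B \<in> carrier_mat m m \<Longrightarrow> mat_trace (A + B) = mat_trace A + mat_trace B"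
  by (auto simp: mat_trace_def sum.distrib)

lemma mat_trace_minus:
  fixes A :: "'a::ring mat"
  shows "A \<in> carrier_mat m m \<Longrightarrow> B \<in> carrier_mat m m \<Longrightarrow> mat_trace (A - B) = mat_trace A - mat_trace B"
  by (auto simp: mat_trace_def sum_subtractf)

lemma mat_trace_smult:
  fixes A :: "'a::semiring_0 mat"
  shows "A \<in> carrier_mat m m \<Longrightarrow> mat_trace (c \<cdot>\<^sub>m A) = c * mat_trace A"
  by (auto simp: mat_trace_def sum_distrib_left)

lemma mat_trace_mult_commute:
  fixes A B :: "'a::comm_semiring_0 mat"
  assumes A: "A \<in> carrier_mat m m" and B: "B \<in> carrier_mat m m"
  shows "mat_trace (A * B) = mat_trace (B * A)"
proof -
  have tr: "mat_trace (A * B) = (\<Sum>i<m. \<Sum>k<m. A $$ (i, k) * B $$ (k, i))"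
    if "A \<in> carrier_mat m m" "B \<in> carrier_mat m m" for A B :: "'a mat"
    using that by (simp add: mat_trace_def mult_mat_index_sum[OF that] del: index_mult_mat(1))
  show ?thesis
    unfolding tr[OF A B] tr[OF B A] by (subst sum.swap) (simp add: mult.commute)
qed

lemma vectorspace_sl: "vectorspace (class_ring :: 'a::field ring) (sl m)"
proof -
  have "abelian_group (sl m :: ('a, 'a mat) lie_algebra)"
  proof (rule abelian_groupI)
    fix A :: "'a mat" assume "A \<in> carrier (sl m)"
    then show "\<exists>B\<in>carrier (sl m). B \<oplus>\<^bsub>sl m\<^esub> A = \<zero>\<^bsub>sl m\<^esub>"
      by (intro bexI[of _ "(-1) \<cdot>\<^sub>m A"]) (auto simp: sl_simps mat_trace_smult)
  qed (auto simp: sl_simps mat_trace_add mat_trace_def intro: assoc_add_mat comm_add_mat)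
  moreover have "module_axioms (class_ring :: 'a ring) (sl m)"
    by (rule module_axioms.intro)
      (auto simp: sl_simps mat_trace_smult add_smult_distrib_left_mat add_smult_distrib_right_mat)
  ultimately show ?thesis
    using class_field.field_axioms class_cring.cring_axioms
    by (simp add: vectorspace_def Module.module_def)
qed

lemma vectorspace_natural_sl: "vectorspace (class_ring :: 'a::field ring) (natural_sl m)"
proof (rule vectorspace_cong)
  show "vectorspace (class_ring :: 'a ring) (module_vec TYPE('a) m)"
    using vec_vs .
qed (simp_all add: natural_sl_simps module_vec_simps)

text \<open>Expanded by distributivity and associativity, each of the six triple products occurs once with
  each sign.\<close>

lemma commutator_jacobi:
  fixes A B C :: "'a::ring mat"
  assumes "A \<in> carrier_mat m m" "B \<in> carrier_mat m m" "C \<in> carrier_mat m m"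
  shows "A * (B * C - C * B) - (B * C - C * B) * A + (B * (C * A - A * C) - (C * A - A * C) * B)
    + (C * (A * B - B * A) - (A * B - B * A) * C) = 0\<^sub>m m m"
  using assms
  by (intro eq_matI) (auto simp: mult_minus_distrib_mat[of _ m m _ m] minus_mult_distrib_mat[of _ m m]
      assoc_mult_mat[of _ m m _ m _ m] simp del: index_mult_mat(1))

lemma lie_algebra_sl: "lie_algebra (class_ring :: 'a::field ring) (sl m)"
proof -
  show ?thesis
  proof (rule lie_algebra.intro[OF vectorspace_sl], rule lie_algebra_axioms.intro)
    fix A B C :: "'a mat" and c :: 'a
    assume sl: "A \<in> carrier (sl m)" "B \<in> carrier (sl m)"
    then have AB: "A \<in> carrier_mat m m" "B \<in> carrier_mat m m" by (auto simp: sl_simps)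
    show "lie_bracket (sl m) A B \<in> carrier (sl m)"
      using AB by (simp add: sl_simps mat_trace_minus[of _ m] mat_trace_mult_commute[of A m B]
          minus_carrier_mat)
    show "lie_bracket (sl m) A A = \<zero>\<^bsub>sl m\<^esub>"
      using AB by (intro eq_matI) (auto simp: sl_simps)
    show "lie_bracket (sl m) (c \<odot>\<^bsub>sl m\<^esub> A) B = c \<odot>\<^bsub>sl m\<^esub> lie_bracket (sl m) A B"
      "lie_bracket (sl m) A (c \<odot>\<^bsub>sl m\<^esub> B) = c \<odot>\<^bsub>sl m\<^esub> lie_bracket (sl m) A B"
      using AB
      by (auto simp: sl_simps mult_smult_assoc_mat[of _ m m] mult_smult_distrib[of _ m m]
          right_diff_distrib simp del: index_mult_mat(1) intro!: eq_matI)
    assume "C \<in> carrier (sl m)"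
    then have C: "C \<in> carrier_mat m m" by (auto simp: sl_simps)
    show "lie_bracket (sl m) (A \<oplus>\<^bsub>sl m\<^esub> B) C =
        lie_bracket (sl m) A C \<oplus>\<^bsub>sl m\<^esub> lie_bracket (sl m) B C"
      "lie_bracket (sl m) A (B \<oplus>\<^bsub>sl m\<^esub> C) =
        lie_bracket (sl m) A B \<oplus>\<^bsub>sl m\<^esub> lie_bracket (sl m) A C"
      using AB C
      by (auto simp: sl_simps add_mult_distrib_mat[of _ m m] mult_add_distrib_mat[of _ m m]
          simp del: index_mult_mat(1) intro!: eq_matI)
    show "lie_bracket (sl m) A (lie_bracket (sl m) B C) \<oplus>\<^bsub>sl m\<^esub>
        lie_bracket (sl m) B (lie_bracket (sl m) C A) \<oplus>\<^bsub>sl m\<^esub>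
        lie_bracket (sl m) C (lie_bracket (sl m) A B) = \<zero>\<^bsub>sl m\<^esub>"
      using commutator_jacobi[OF AB C] by (simp add: sl_simps)
  qed
qed

lemma lie_module_natural_sl:
  "lie_module (class_ring :: 'a::field ring) (sl m) (natural_sl m)"
proof (rule lie_moduleI[OF lie_algebra_sl vectorspace_natural_sl])
  fix A B :: "'a mat" and v :: "'a vec"
  assume "A \<in> carrier (sl m)" "B \<in> carrier (sl m)" "v \<in> carrier (natural_sl m)"
  then have *: "A \<in> carrier_mat m m" "B \<in> carrier_mat m m" "v \<in> carrier_vec m"
    by (auto simp: sl_simps natural_sl_simps)
  have "(A * B - B * A) *\<^sub>v v + B *\<^sub>v (A *\<^sub>v v) = A *\<^sub>v (B *\<^sub>v v)"
    using * by (intro eq_vecI)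
      (auto simp: minus_mult_distrib_mat_vec[of _ m m] assoc_mult_mat_vec[of _ m m _ m]
        simp del: index_mult_mat_vec)
  then show "act (natural_sl m) (lie_bracket (sl m) A B) v \<oplus>\<^bsub>natural_sl m\<^esub>
      act (natural_sl m) B (act (natural_sl m) A v) = act (natural_sl m) A (act (natural_sl m) B v)"
    by (simp add: sl_simps natural_sl_simps)
qed (auto simp: sl_simps natural_sl_simps add_mult_distrib_mat_vec[of _ m m]
    mult_add_distrib_mat_vec[of _ m m] smult_mat_mult_vec[of _ m m] mult_mat_vec[of _ m m])

section \<open>Natural systems are given by block vectors\<close>

lemma pullback_simps:
  "carrier (pullback f V) = carrier V"
  "add (pullback f V) = add V"
  "zero (pullback f V) = zero V"
  "module.smult (pullback f V) = module.smult V"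
  "act (pullback f V) = (\<lambda>x. act V (f x))"
  by (simp_all add: pullback_def)

lemma block_vec_hom:
  fixes w :: "'a::field vec"
  assumes w: "w \<in> carrier_vec n"
  shows "block_vec w \<in> lie_module_hom class_ring (sl m) (natural_sl m)
    (pullback (diag_embed n) (natural_sl (n * m)))"
  by (rule lie_module_homI)
    (auto simp: pullback_simps natural_sl_simps sl_simps block_vec_carrier[OF w]
      block_vec_add[OF w] block_vec_smult_right diag_embed_mult_block_vec[OF _ w])

text \<open>A homomorphism \<open>\<phi>\<close> is determined by its value \<open>y\<close> at the first unit vector \<open>e\<close>, because every
  \<open>x\<close> is \<open>A e\<close> for a traceless \<open>A\<close>, and then \<open>\<phi> x = diag(A, \<dots>, A) y\<close>.  Such an \<open>A\<close> has first column
  \<open>x\<close>, and its trace is corrected in position \<open>(1, 1)\<close> (counting from \<open>0\<close>), which exists because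
  \<open>m \<ge> 2\<close>.  This correction does not contribute to \<open>\<phi> x\<close>: the elementary matrix in position
  \<open>(0, 1)\<close> kills \<open>e\<close>, hence \<open>y\<close>, so that the entries of \<open>y\<close> in position \<open>1\<close> of each block
  vanish.  The entries in position \<open>0\<close> of the blocks are the coordinates of \<open>w\<close>.\<close>

lemma natural_hom_is_block_vec:
  fixes \<phi> :: "'a::field vec \<Rightarrow> 'a vec"
  assumes m: "m \<ge> 2"
    and hom: "\<phi> \<in> lie_module_hom class_ring (sl m) (natural_sl m)
      (pullback (diag_embed n) (natural_sl (n * m)))"
  obtains w where "w \<in> carrier_vec n" "\<And>x. x \<in> carrier_vec m \<Longrightarrow> \<phi> x = block_vec w x"
proof -
  note homD = lie_module_homD[OF hom, unfolded pullback_simps natural_sl_simps sl_simps]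
  define e :: "'a vec" where "e = unit_vec m 0"
  define y where "y = \<phi> e"
  have e: "e \<in> carrier_vec m" by (simp add: e_def)
  have y: "y \<in> carrier_vec (n * m)" unfolding y_def using homD(1)[OF e] .
  have act: "\<phi> (A *\<^sub>v x) = diag_embed n A *\<^sub>v \<phi> x"
    if "A \<in> carrier_mat m m" "mat_trace A = 0" "x \<in> carrier_vec m" for A x
    using homD(4)[of A x] that by simp
  have zero: "\<phi> (0\<^sub>v m) = 0\<^sub>v (n * m)"
  proof -
    have "\<phi> (0 \<cdot>\<^sub>v e) = 0 \<cdot>\<^sub>v \<phi> e" using homD(3)[of 0 e] e by simp
    moreover have "0 \<cdot>\<^sub>v e = 0\<^sub>v m" "0 \<cdot>\<^sub>v \<phi> e = 0\<^sub>v (n * m)" using e y by (auto simp: y_def)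
    ultimately show ?thesis by simp
  qed
  have mult_e: "A *\<^sub>v e = vec m (\<lambda>i. A $$ (i, 0))" if "A \<in> carrier_mat m m" for A
  proof (rule eq_vecI)
    fix i assume "i < dim_vec (vec m (\<lambda>i. A $$ (i, 0)))"
    then have i: "i < m" by simp
    have "(A *\<^sub>v e) $ i = (\<Sum>k<m. A $$ (i, k) * e $ k)"
      by (rule mult_mat_vec_index_sum[OF that e i])
    also have "\<dots> = (\<Sum>k<m. if k = 0 then A $$ (i, k) else 0)"
      using m by (intro sum.cong) (auto simp: e_def)
    finally have "(A *\<^sub>v e) $ i = (\<Sum>k<m. if k = 0 then A $$ (i, k) else 0)" .
    then show "(A *\<^sub>v e) $ i = vec m (\<lambda>i. A $$ (i, 0)) $ i" using i m by simp
  qed (use that in auto)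
  have y1: "y $ (b * m + 1) = 0" if b: "b < n" for b
  proof -
    \<comment> \<open>The elementary matrix in position \<open>(0, 1)\<close>.\<close>
    define E :: "'a mat" where "E = mat m m (\<lambda>(i, j). if i = 0 \<and> j = 1 then 1 else 0)"
    have E: "E \<in> carrier_mat m m" "mat_trace E = 0"
      by (auto simp: E_def mat_trace_def intro!: sum.neutral)
    have "E *\<^sub>v e = 0\<^sub>v m"
      by (subst mult_e[OF E(1)]) (auto simp: E_def)
    then have Ey: "diag_embed n E *\<^sub>v y = 0\<^sub>v (n * m)"
      using act[OF E e] zero by (simp add: y_def)
    have i: "b * m < n * m" using block_index_less[OF b, of 0 m] m by simp
    have "(diag_embed n E *\<^sub>v y) $ (b * m) =
        (\<Sum>l<m. E $$ (b * m mod m, l) * y $ (b * m div m * m + l))"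
      by (rule diag_embed_mult_vec_index[OF E(1) y i])
    also have "\<dots> = (\<Sum>l<m. if l = 1 then y $ (b * m + l) else 0)"
      using m by (intro sum.cong) (auto simp: E_def)
    also have "\<dots> = y $ (b * m + 1)" using m by (subst sum.delta) auto
    finally show ?thesis using Ey i by simp
  qed
  define w where "w = vec n (\<lambda>b. y $ (b * m))"
  show thesis
  proof (rule that)
    show w: "w \<in> carrier_vec n" by (simp add: w_def)
    fix x :: "'a vec" assume x: "x \<in> carrier_vec m"
    define A where
      "A = mat m m (\<lambda>(i, j). if j = 0 then x $ i else if i = 1 \<and> j = 1 then - x $ 0 else 0)"
    have A: "A \<in> carrier_mat m m" by (simp add: A_def)
    have "mat_trace A = (\<Sum>i<m. (if i = 0 then x $ 0 else 0) - (if i = 1 then x $ 0 else 0))"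
      using m by (auto simp: mat_trace_def A_def intro!: sum.cong)
    also have "\<dots> = 0" using m by (simp add: sum_subtractf)
    finally have trace: "mat_trace A = 0" .
    have "A *\<^sub>v e = x"
      using x m by (subst mult_e[OF A]) (auto simp: A_def)
    then have \<phi>x: "\<phi> x = diag_embed n A *\<^sub>v y"
      using act[OF A trace e] by (simp add: y_def)
    show "\<phi> x = block_vec w x"
    proof (rule eq_vecI)
      fix i assume "i < dim_vec (block_vec w x)"
      then have i: "i < n * m" using block_vec_carrier[OF w x] by simp
      note b = div_less_of_mult[OF i] and j = mod_less_of_mult[OF i]
      have "\<phi> x $ i = (\<Sum>l<m. A $$ (i mod m, l) * y $ (i div m * m + l))"
        unfolding \<phi>x by (rule diag_embed_mult_vec_index[OF A y i])
      also have "\<dots> = (\<Sum>l<m. if l = 0 then x $ (i mod m) * y $ (i div m * m) else 0)"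
        using j y1[OF b] by (intro sum.cong) (auto simp: A_def)
      also have "\<dots> = x $ (i mod m) * y $ (i div m * m)"
        using m by simp
      finally show "\<phi> x $ i = block_vec w x $ i"
        unfolding block_vec_index[OF w x i] using b by (simp add: w_def mult.commute)
    qed (use homD(1)[OF x] block_vec_carrier[OF w x] in auto)
  qed
qed

lemma natural_system_alt:
  "natural_system n \<phi> \<longleftrightarrow> (\<forall>k.
    \<phi> k \<in> lie_module_hom class_ring (sl (n ^ (k + 1))) (natural_sl (n ^ (k + 1)))
      (pullback (diag_embed n) (natural_sl (n * n ^ (k + 1)))) \<and>
    (\<exists>x \<in> carrier_vec (n ^ (k + 1)). \<phi> k x \<noteq> 0\<^sub>v (n * n ^ (k + 1))))"
  by (simp add: natural_system_def)

lemma natural_system_block_vec: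
  fixes w :: "nat \<Rightarrow> 'a::field vec"
  assumes w: "\<And>k. w k \<in> carrier_vec n - {0\<^sub>v n}"
  shows "natural_system n (\<lambda>k. block_vec (w k))"
  unfolding natural_system_alt
proof (intro allI conjI)
  fix k
  have wk: "w k \<in> carrier_vec n" "w k \<noteq> 0\<^sub>v n" using w[of k] by auto
  then have "0 < n" by (cases n) auto
  let ?m = "n ^ (k + 1)"
  show "block_vec (w k) \<in> lie_module_hom class_ring (sl ?m) (natural_sl ?m)
      (pullback (diag_embed n) (natural_sl (n * ?m)))"
    by (rule block_vec_hom[OF wk(1)])
  let ?e = "unit_vec ?m 0 :: 'a vec"
  have "block_vec (w k) (0\<^sub>v ?m) = 0\<^sub>v (n * ?m)"
    using wk(1) by (intro eq_vecI) (auto simp: block_vec_def mod_less_of_mult)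
  moreover have "?e \<noteq> 0\<^sub>v ?m"
    using \<open>0 < n\<close> by (metis index_unit_vec(1) index_zero_vec(1) zero_less_power zero_neq_one)
  ultimately have "block_vec (w k) ?e \<noteq> 0\<^sub>v (n * ?m)"
    using block_vec_right_cancel[OF wk, of ?e ?m "0\<^sub>v ?m"] by auto
  then show "\<exists>x\<in>carrier_vec ?m. block_vec (w k) x \<noteq> 0\<^sub>v (n * ?m)"
    by (intro bexI[of _ ?e]) auto
qed

lemma natural_system_obtain_block_vec:
  fixes \<phi> :: "nat \<Rightarrow> 'a::field vec \<Rightarrow> 'a vec"
  assumes n: "n \<ge> 2" and \<phi>: "natural_system n \<phi>"
  obtains w where "\<And>k. w k \<in> carrier_vec n - {0\<^sub>v n}"
    "\<And>k x. x \<in> carrier_vec (n ^ (k + 1)) \<Longrightarrow> \<phi> k x = block_vec (w k) x"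
proof -
  have "\<exists>w. w \<in> carrier_vec n - {0\<^sub>v n} \<and>
      (\<forall>x\<in>carrier_vec (n ^ (k + 1)). \<phi> k x = block_vec w x)" for k
  proof -
    let ?m = "n ^ (k + 1)"
    have m: "?m \<ge> 2" using mult_le_mono[OF n, of 1 "n ^ k"] n by simp
    have hom: "\<phi> k \<in> lie_module_hom class_ring (sl ?m) (natural_sl ?m)
        (pullback (diag_embed n) (natural_sl (n * ?m)))"
      and nz: "\<exists>x\<in>carrier_vec ?m. \<phi> k x \<noteq> 0\<^sub>v (n * ?m)"
      using \<phi> unfolding natural_system_alt by blast+
    obtain w where w: "w \<in> carrier_vec n" "\<And>x. x \<in> carrier_vec ?m \<Longrightarrow> \<phi> k x = block_vec w x"
      using natural_hom_is_block_vec[OF m hom] by blast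
    obtain x where x: "x \<in> carrier_vec ?m" "block_vec w x \<noteq> 0\<^sub>v (n * ?m)"
      using nz w(2) by auto
    have "block_vec (0\<^sub>v n) x = 0\<^sub>v (n * ?m)"
      using x(1) by (intro eq_vecI) (auto simp: block_vec_def div_less_of_mult)
    then have "w \<noteq> 0\<^sub>v n" using x(2) by blast
    then show ?thesis using w by blast
  qed
  then obtain w where "\<forall>k. w k \<in> carrier_vec n - {0\<^sub>v n} \<and>
      (\<forall>x\<in>carrier_vec (n ^ (k + 1)). \<phi> k x = block_vec (w k) x)"
    by metis
  then show thesis using that by blast
qed

lemma sl_system:
  "lie_algebra_system (class_ring :: 'a::field ring) (\<lambda>k. sl (n ^ (k + 1))) (\<lambda>_. diag_embed n)"
proof (intro lie_algebra_system.intro vectorspace_system.intro lie_algebra_system_axioms.intro)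
  fix k
  let ?m = "n ^ (k + 1)"
  have m: "n ^ (Suc k + 1) = n * ?m" by simp
  show "vectorspace (class_ring :: 'a ring) (sl ?m)" by (rule vectorspace_sl)
  show "lie_algebra (class_ring :: 'a ring) (sl ?m)" by (rule lie_algebra_sl)
  show "diag_embed n \<in> LinearCombinations.module_hom (class_ring :: 'a ring)
      (sl ?m) (sl (n ^ (Suc k + 1)))"
    unfolding m LinearCombinations.module_hom_def
    by (auto simp: sl_simps diag_embed_carrier mat_trace_diag_embed diag_embed_add
        diag_embed_smult simp del: power_Suc)
  fix A B :: "'a mat" assume "A \<in> carrier (sl ?m)" "B \<in> carrier (sl ?m)"
  then have A: "A \<in> carrier_mat ?m ?m" and B: "B \<in> carrier_mat ?m ?m"
    unfolding sl_simps by blast+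
  show "diag_embed n (lie_bracket (sl ?m) A B) =
      lie_bracket (sl (n ^ (Suc k + 1))) (diag_embed n A) (diag_embed n B)"
    by (simp only: sl_simps diag_embed_mult[OF A B] diag_embed_mult[OF B A]
        diag_embed_minus[OF mult_carrier_mat[OF A B] mult_carrier_mat[OF B A]])
qed

lemma natural_lie_module_system:
  fixes \<phi> :: "nat \<Rightarrow> 'a::field vec \<Rightarrow> 'a vec"
  assumes "natural_system n \<phi>"
  shows "lie_module_system class_ring (\<lambda>k. sl (n ^ (k + 1))) (\<lambda>_. diag_embed n)
    (\<lambda>k. natural_sl (n ^ (k + 1))) \<phi>"
proof (intro lie_module_system.intro sl_system vectorspace_system.intro
    lie_module_system_axioms.intro)
  fix k
  let ?m = "n ^ (k + 1)"
  have m: "n ^ (Suc k + 1) = n ^ (k + 2)" by simp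
  have hom: "\<phi> k \<in> lie_module_hom class_ring (sl ?m) (natural_sl ?m)
      (pullback (diag_embed n) (natural_sl (n ^ (k + 2))))"
    using assms unfolding natural_system_def by blast
  show "vectorspace (class_ring :: 'a ring) (natural_sl ?m)" by (rule vectorspace_natural_sl)
  show "lie_module (class_ring :: 'a ring) (sl ?m) (natural_sl ?m)" by (rule lie_module_natural_sl)
  show "\<phi> k \<in> LinearCombinations.module_hom class_ring (natural_sl ?m) (natural_sl (n ^ (Suc k + 1)))"
    using lie_module_homD[OF hom] unfolding m LinearCombinations.module_hom_def
    by (auto simp: pullback_simps)
  fix A :: "'a mat" and v :: "'a vec"
  assume "A \<in> carrier (sl ?m)" "v \<in> carrier (natural_sl ?m)"
  then show "\<phi> k (act (natural_sl ?m) A v) = act (natural_sl (n ^ (Suc k + 1))) (diag_embed n A) (\<phi> k v)"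
    using lie_module_homD(4)[OF hom] unfolding m by (simp add: pullback_simps)
qed

lemma lie_module_natural_limit:
  fixes \<phi> :: "nat \<Rightarrow> 'a::field vec \<Rightarrow> 'a vec"
  assumes "natural_system n \<phi>"
  shows "lie_module class_ring (sl_infinity n) (natural_limit n \<phi>)"
  unfolding sl_infinity_def natural_limit_def
  by (rule lie_module_system.lie_module_VLim[OF natural_lie_module_system[OF assms]])

lemma natural_limit_representation:
  fixes \<phi> :: "nat \<Rightarrow> 'a::field vec \<Rightarrow> 'a vec"
  assumes "natural_system n \<phi>"
  shows "natural_limit n \<phi> \<in> natural_representations n"
  using assms lie_module_natural_limit[OF assms] lie_module_isomorphic_refl
  by (auto simp: natural_representations_def)

section \<open>Sequences with the same tail have isomorphic limits\<close>

text \<open>If the transition maps \<open>\<psi> k\<close> and \<open>\<phi> k\<close> differ by the factor \<open>c k\<close> from stage \<open>N\<close> on, then scaling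
  stage \<open>m\<close> by \<open>c 0 \<cdots> c (m - 1)\<close> intertwines them.  The values of \<open>c\<close> before \<open>N\<close> are
  arbitrary nonzero scalars: they scale all later stages by a common constant.\<close>

lemma natural_limits_isomorphic:
  fixes \<phi> \<psi> :: "nat \<Rightarrow> 'a::field vec \<Rightarrow> 'a vec"
  assumes \<phi>: "natural_system n \<phi>" and \<psi>: "natural_system n \<psi>"
    and nz: "\<And>k. c k \<noteq> 0"
    and eq: "\<And>k x. N \<le> k \<Longrightarrow> x \<in> carrier_vec (n ^ (k + 1)) \<Longrightarrow> \<psi> k x = c k \<cdot>\<^sub>v \<phi> k x"
  shows "lie_module_isomorphic class_ring (sl_infinity n) (natural_limit n \<phi>) (natural_limit n \<psi>)"
proof -
  define d where "d m = (\<Prod>i<m. c i)" for m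
  have d: "d m \<noteq> 0" for m using nz by (simp add: d_def)
  have hom: "\<psi> k \<in> lie_module_hom class_ring (sl (n ^ (k + 1))) (natural_sl (n ^ (k + 1)))
      (pullback (diag_embed n) (natural_sl (n ^ (k + 2))))" for k
    using \<psi> unfolding natural_system_def by blast
  show ?thesis
    unfolding sl_infinity_def natural_limit_def
  proof (rule lim_lie_module_isomorphic[OF natural_lie_module_system[OF \<phi>]
        natural_lie_module_system[OF \<psi>], where N = N and h = "\<lambda>m x. d m \<cdot>\<^sub>v x"])
    fix m
    let ?m = "n ^ (m + 1)"
    show "(\<lambda>x. d m \<cdot>\<^sub>v x) \<in> lie_module_hom class_ring (sl ?m) (natural_sl ?m) (natural_sl ?m)"
      by (rule lie_module_homI)
        (auto simp: natural_sl_simps sl_simps smult_add_distrib_vec smult_smult_assoc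
          mult.commute mult_mat_vec[of _ ?m ?m])
    show "bij_betw (\<lambda>x. d m \<cdot>\<^sub>v x) (carrier (natural_sl ?m)) (carrier (natural_sl ?m))"
      by (rule bij_betw_byWitness[where f' = "\<lambda>x. inverse (d m) \<cdot>\<^sub>v x"])
        (auto simp: natural_sl_simps smult_smult_assoc d)
    fix x :: "'a vec" assume N: "N \<le> m" and "x \<in> carrier (natural_sl ?m)"
    then have x: "x \<in> carrier_vec ?m" by (simp add: natural_sl_simps)
    have "\<psi> m (d m \<cdot>\<^sub>v x) = d m \<cdot>\<^sub>v \<psi> m x"
      using lie_module_homD(3)[OF hom, of "d m" x] x by (simp add: natural_sl_simps pullback_simps)
    then show "\<psi> m (d m \<cdot>\<^sub>v x) = d (Suc m) \<cdot>\<^sub>v \<phi> m x"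
      by (simp add: eq[OF N x] d_def smult_smult_assoc)
  qed
qed

section \<open>Isomorphic limits come from sequences with the same tail\<close>

text \<open>If \<open>f\<close> is a linear form with \<open>f x = 0\<close>, then the rank one matrix \<open>A = x f\<close>, which sends \<open>v\<close> to
  \<open>f(v) x\<close>, has trace \<open>f x = 0\<close> and kills \<open>x\<close>.  Hence it kills \<open>y\<close>, which means that \<open>f y = 0\<close>.
  The forms \<open>f(v) = x\<^sub>i v\<^sub>j - x\<^sub>j v\<^sub>i\<close>, for one \<open>i\<close> with \<open>x\<^sub>i \<noteq> 0\<close> and all \<open>j\<close>, then show that
  \<open>y\<close> is a multiple of \<open>x\<close>.\<close>

lemma annihilator_determines_line:
  fixes x y :: "'a::field vec"
  assumes x: "x \<in> carrier_vec m" "x \<noteq> 0\<^sub>v m" and y: "y \<in> carrier_vec m"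
    and ann: "\<And>A. A \<in> carrier (sl m) \<Longrightarrow> A *\<^sub>v x = 0\<^sub>v m \<Longrightarrow> A *\<^sub>v y = 0\<^sub>v m"
  obtains c where "y = c \<cdot>\<^sub>v x"
proof -
  obtain i where i: "i < m" "x $ i \<noteq> 0"
    using x by (metis eq_vecI carrier_vecD dim_vec index_zero_vec(1,2))
  have "y $ j = (y $ i / x $ i) * x $ j" if j: "j < m" for j
  proof -
    define A where "A = mat m m (\<lambda>(p, l). x $ p *
      ((if l = j then x $ i else 0) - (if l = i then x $ j else 0)))"
    have A: "A \<in> carrier_mat m m" by (simp add: A_def)
    have Av: "A *\<^sub>v v = vec m (\<lambda>p. x $ p * (x $ i * v $ j - x $ j * v $ i))"
      if v: "v \<in> carrier_vec m" for v
    proof (rule eq_vecI)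
      fix p assume "p < dim_vec (vec m (\<lambda>p. x $ p * (x $ i * v $ j - x $ j * v $ i)))"
      then have p: "p < m" by simp
      have "(A *\<^sub>v v) $ p = (\<Sum>l<m. (if l = j then x $ p * x $ i * v $ l else 0) -
          (if l = i then x $ p * x $ j * v $ l else 0))"
        using p by (subst mult_mat_vec_index_sum[OF A v])
          (auto simp: A_def algebra_simps intro!: sum.cong)
      then show "(A *\<^sub>v v) $ p = vec m (\<lambda>p. x $ p * (x $ i * v $ j - x $ j * v $ i)) $ p"
        using i j p by (simp add: sum_subtractf algebra_simps)
    qed (use A v in auto)
    have "mat_trace A = (\<Sum>p<m. (if p = j then x $ p * x $ i else 0) -
        (if p = i then x $ p * x $ j else 0))"
      by (auto simp: mat_trace_def A_def algebra_simps intro!: sum.cong)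
    also have "\<dots> = 0" using i j by (simp add: sum_subtractf mult.commute)
    finally have "A \<in> carrier (sl m)" using A by (simp add: sl_simps)
    moreover have "A *\<^sub>v x = 0\<^sub>v m"
      by (subst Av[OF x(1)]) (auto simp: mult.commute)
    ultimately have "A *\<^sub>v y = 0\<^sub>v m" by (rule ann)
    then have "x $ i * (x $ i * y $ j - x $ j * y $ i) = 0"
      using i(1) by (metis Av[OF y] index_vec index_zero_vec(1))
    then show ?thesis using i(2) by (simp add: field_simps)
  qed
  then have "y = (y $ i / x $ i) \<cdot>\<^sub>v x"
    using x y by (intro eq_vecI) auto
  then show thesis by (rule that)
qed

text \<open>An isomorphism \<open>h\<close> preserves annihilators, so it is enough to follow one nonzero element \<open>A\<close>
  of the limit.  At every late stage \<open>m\<close>, let \<open>x m\<close> represent \<open>A\<close> and let \<open>y m\<close> represent \<open>h A\<close>.  The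
  transition maps are injective, so a matrix of stage \<open>m\<close> kills \<open>A\<close> if and only if it kills
  \<open>x m\<close>, and likewise for \<open>h A\<close> and \<open>y m\<close>.  By the preceding lemma \<open>x m\<close> and \<open>y m\<close> are
  proportional.  Comparing this at stages \<open>k\<close> and \<open>k + 1\<close> gives that the block vectors of
  \<open>w k\<close> and \<open>w' k\<close> with \<open>x k\<close> are proportional, and \<open>x k\<close> cancels.\<close>

lemma isomorphic_limits_same_tail:
  fixes w w' :: "nat \<Rightarrow> 'a::field vec"
  assumes w: "\<And>k. w k \<in> carrier_vec n - {0\<^sub>v n}" and w': "\<And>k. w' k \<in> carrier_vec n - {0\<^sub>v n}"
    and iso: "lie_module_isomorphic class_ring (sl_infinity n)
      (natural_limit n (\<lambda>k. block_vec (w k))) (natural_limit n (\<lambda>k. block_vec (w' k)))"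
  shows "\<exists>N. \<forall>k\<ge>N. \<exists>c. c \<noteq> 0 \<and> w' k = c \<cdot>\<^sub>v w k"
proof -
  let ?\<phi> = "\<lambda>k. block_vec (w k)" and ?\<psi> = "\<lambda>k. block_vec (w' k)"
  let ?X = "\<lambda>k. carrier_vec (n ^ (k + 1)) :: 'a vec set"
  have n: "0 < n" using w[of 0] by (cases n) auto
  interpret V: lie_module_system class_ring "\<lambda>k. sl (n ^ (k + 1))" "\<lambda>_. diag_embed n"
    "\<lambda>k. natural_sl (n ^ (k + 1))" ?\<phi>
    by (rule natural_lie_module_system[OF natural_system_block_vec[OF w]])
  interpret W: lie_module_system class_ring "\<lambda>k. sl (n ^ (k + 1))" "\<lambda>_. diag_embed n"
    "\<lambda>k. natural_sl (n ^ (k + 1))" ?\<psi>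
    by (rule natural_lie_module_system[OF natural_system_block_vec[OF w']])
  interpret VL: lie_module class_ring V.L.LLim V.VLim by (rule V.lie_module_VLim)
  interpret WL: lie_module class_ring V.L.LLim W.VLim by (rule W.lie_module_VLim)
  have X: "V.V.X = ?X" by (simp add: natural_sl_simps fun_eq_iff)
  have inj_block: "inj_on (block_vec u) (?X k)" if "u \<in> carrier_vec n - {0\<^sub>v n}" for u :: "'a vec" and k
    using that block_vec_right_cancel by (intro inj_onI) blast
  have V_inj: "x = y" if "x \<in> ?X m" "y \<in> ?X m" "V.V.lim_cls m x = V.V.lim_cls m y" for x y m
    using V.V.lim_class_inj[of x m y] inj_block[OF w] that by (simp add: natural_sl_simps)
  have W_inj: "x = y" if "x \<in> ?X m" "y \<in> ?X m" "W.V.lim_cls m x = W.V.lim_cls m y" for x y m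
    using W.V.lim_class_inj[of x m y] inj_block[OF w'] that by (simp add: natural_sl_simps)
  have V_zero: "\<zero>\<^bsub>V.VLim\<^esub> = V.V.lim_cls m (0\<^sub>v (n ^ (m + 1)))"
    and W_zero: "\<zero>\<^bsub>W.VLim\<^esub> = W.V.lim_cls m (0\<^sub>v (n ^ (m + 1)))" for m
    using V.V.Lim_zero[of m] W.V.Lim_zero[of m] by (simp_all add: lim_lie_module_simps natural_sl_simps)
  have V_act: "act V.VLim (V.L.lim_cls m S) (V.V.lim_cls m v) = V.V.lim_cls m (S *\<^sub>v v)"
    and W_act: "act W.VLim (V.L.lim_cls m S) (W.V.lim_cls m v) = W.V.lim_cls m (S *\<^sub>v v)"
    if "S \<in> carrier (sl (n ^ (m + 1)))" "v \<in> ?X m" for S v m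
    using V.VLim_act[OF that(1), of v] W.VLim_act[OF that(1), of v] that(2)
    by (simp_all add: natural_sl_simps)
  obtain h where h: "h \<in> lie_module_hom class_ring V.L.LLim V.VLim W.VLim"
    and bij: "bij_betw h (carrier V.VLim) (carrier W.VLim)"
    using iso unfolding lie_module_isomorphic_def sl_infinity_def natural_limit_def by blast
  have h_zero: "h \<zero>\<^bsub>V.VLim\<^esub> = \<zero>\<^bsub>W.VLim\<^esub>"
    using lie_module_homD(3)[OF h _ VL.V.M.zero_closed, of 0]
      VL.V.smult_l_null[OF VL.V.M.zero_closed]
      WL.V.smult_l_null[OF lie_module_homD(1)[OF h VL.V.M.zero_closed]]
    by simp
  define x where "x m = transition ?\<phi> 0 m (unit_vec n 0)" for m
  define A where "A = V.V.lim_cls 0 (unit_vec n 0)"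
  have x0: "unit_vec n 0 \<in> V.V.X 0" by (simp add: natural_sl_simps)
  have x: "x m \<in> ?X m" and A_x: "A = V.V.lim_cls m (x m)" for m
    using V.V.transition_closed[OF _ x0, of m] V.V.lim_class_transition[OF _ x0, of m]
    by (simp_all add: x_def A_def natural_sl_simps)
  have A: "A \<in> carrier V.VLim"
    using V.V.Lim_carrier[OF x0] by (simp add: A_def lim_lie_module_simps)
  have "unit_vec n 0 \<noteq> (0\<^sub>v n :: 'a vec)"
    using n by (metis index_unit_vec(1) index_zero_vec(1) zero_neq_one)
  then have A_nz: "A \<noteq> \<zero>\<^bsub>V.VLim\<^esub>"
    using V_inj[of "unit_vec n 0" 0 "0\<^sub>v n"] V_zero[of 0] by (auto simp: A_def)
  have x_nz: "x m \<noteq> 0\<^sub>v (n ^ (m + 1))" for m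
  proof
    assume "x m = 0\<^sub>v (n ^ (m + 1))"
    then have "A = \<zero>\<^bsub>V.VLim\<^esub>" unfolding A_x[of m] V_zero[of m] by (rule arg_cong)
    then show False using A_nz by blast
  qed
  have hA: "h A \<in> carrier W.VLim" by (rule lie_module_homD(1)[OF h A])
  have hA_nz: "h A \<noteq> \<zero>\<^bsub>W.VLim\<^esub>"
  proof
    assume "h A = \<zero>\<^bsub>W.VLim\<^esub>"
    then have "h A = h \<zero>\<^bsub>V.VLim\<^esub>" using h_zero by (rule trans[OF _ sym])
    then have "A = \<zero>\<^bsub>V.VLim\<^esub>"
      using inj_onD[OF bij_betw_imp_inj_on[OF bij] _ A VL.V.M.zero_closed] by blast
    then show False using A_nz by blast
  qed
  have "h A \<in> lim_carrier W.V.X ?\<psi>"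
    using hA by (simp add: lim_lie_module_simps lim_module_simps)
  then obtain N where "\<And>m. N \<le> m \<Longrightarrow> \<exists>y\<in>W.V.X m. h A = W.V.lim_cls m y"
    using W.V.lim_carrier_stages by blast
  then obtain y where y: "\<And>m. N \<le> m \<Longrightarrow> y m \<in> ?X m"
    and hA_y: "\<And>m. N \<le> m \<Longrightarrow> h A = W.V.lim_cls m (y m)"
    unfolding natural_sl_simps by metis
  have proportional: "\<exists>c. c \<noteq> 0 \<and> y m = c \<cdot>\<^sub>v x m" if m: "N \<le> m" for m
  proof -
    obtain c where c: "y m = c \<cdot>\<^sub>v x m"
    proof (rule annihilator_determines_line[OF x x_nz y[OF m]])
      fix S :: "'a mat" assume S: "S \<in> carrier (sl (n ^ (m + 1)))"
        and Sx: "S *\<^sub>v x m = 0\<^sub>v (n ^ (m + 1))"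
      have S_lim: "V.L.lim_cls m S \<in> carrier V.L.LLim"
        using V.L.Lim_carrier[OF S] by (simp add: lim_lie_algebra_simps)
      have "act V.VLim (V.L.lim_cls m S) A = \<zero>\<^bsub>V.VLim\<^esub>"
        unfolding A_x[of m] V_act[OF S x] Sx V_zero[of m] by (rule refl)
      then have "act W.VLim (V.L.lim_cls m S) (h A) = \<zero>\<^bsub>W.VLim\<^esub>"
        using lie_module_homD(4)[OF h S_lim A] h_zero by metis
      then have "W.V.lim_cls m (S *\<^sub>v y m) = W.V.lim_cls m (0\<^sub>v (n ^ (m + 1)))"
        unfolding hA_y[OF m] W_act[OF S y[OF m]] W_zero[of m] .
      then show "S *\<^sub>v y m = 0\<^sub>v (n ^ (m + 1))"
        using S y[OF m] by (intro W_inj) (auto simp: sl_simps)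
    qed
    have "c \<noteq> 0"
    proof
      assume "c = 0"
      then have "y m = 0\<^sub>v (n ^ (m + 1))" using c x[of m] by (auto intro!: eq_vecI)
      then have "h A = \<zero>\<^bsub>W.VLim\<^esub>" unfolding hA_y[OF m] W_zero[of m] by (rule arg_cong)
      then show False using hA_nz by blast
    qed
    then show ?thesis using c by blast
  qed
  have "\<exists>c. c \<noteq> 0 \<and> w' k = c \<cdot>\<^sub>v w k" if k: "N \<le> k" for k
  proof -
    have wk: "w k \<in> carrier_vec n" "w' k \<in> carrier_vec n" using w w' by auto
    obtain c where c: "c \<noteq> 0" "y k = c \<cdot>\<^sub>v x k" using proportional[OF k] by blast
    obtain c' where c': "c' \<noteq> 0" "y (Suc k) = c' \<cdot>\<^sub>v x (Suc k)" using proportional[of "Suc k"] k by auto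
    have "x (Suc k) = block_vec (w k) (x k)"
      by (simp add: x_def transition_Suc)
    moreover have "y (Suc k) = block_vec (w' k) (y k)"
    proof (rule W_inj)
      show "y (Suc k) \<in> ?X (Suc k)" using y[of "Suc k"] k by simp
      show "block_vec (w' k) (y k) \<in> ?X (Suc k)"
        using block_vec_carrier[OF wk(2) y[OF k]] by simp
      have "W.V.lim_cls (Suc k) (block_vec (w' k) (y k)) = W.V.lim_cls k (y k)"
        using W.V.lim_class_step[of "y k" k] y[OF k] by (simp add: natural_sl_simps)
      then show "W.V.lim_cls (Suc k) (y (Suc k)) = W.V.lim_cls (Suc k) (block_vec (w' k) (y k))"
        using hA_y[OF k] hA_y[of "Suc k"] k by simp
    qed
    ultimately have blocks: "block_vec (c \<cdot>\<^sub>v w' k) (x k) = block_vec (c' \<cdot>\<^sub>v w k) (x k)"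
      using c c' by (simp add: block_vec_smult_left block_vec_smult_right)
    have eq: "c \<cdot>\<^sub>v w' k = c' \<cdot>\<^sub>v w k"
      by (rule block_vec_left_cancel[where n = n, OF _ _ x x_nz blocks]) (simp_all add: wk)
    have "w' k = (inverse c * c) \<cdot>\<^sub>v w' k"
      using c(1) by simp
    also have "\<dots> = inverse c \<cdot>\<^sub>v (c' \<cdot>\<^sub>v w k)"
      by (simp only: smult_smult_assoc[symmetric] eq)
    also have "\<dots> = (inverse c * c') \<cdot>\<^sub>v w k"
      by (simp only: smult_smult_assoc)
    finally show ?thesis using c(1) c'(1) by (intro exI[of _ "inverse c * c'"]) simp
  qed
  then show ?thesis by blast
qed

section \<open>Tails of sequences of points and isomorphism classes\<close>

lemma projective_point_span:
  assumes p: "p \<in> projective_space n" and u: "u \<in> p - {0\<^sub>v n}"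
  shows "u \<in> carrier_vec n - {0\<^sub>v n}" "p = {c \<cdot>\<^sub>v u | c. True}"
proof -
  obtain v where v: "v \<in> carrier_vec n" "p = {c \<cdot>\<^sub>v v | c. True}"
    using p by (auto simp: projective_space_def)
  obtain a where a: "u = a \<cdot>\<^sub>v v" using u v by auto
  have "a \<noteq> 0"
  proof
    assume "a = 0"
    then have "u = 0\<^sub>v n" using a v by auto
    then show False using u by simp
  qed
  then have "c \<cdot>\<^sub>v v = (c / a) \<cdot>\<^sub>v u" and "c \<cdot>\<^sub>v u = (c * a) \<cdot>\<^sub>v v" for c
    by (simp_all add: a smult_smult_assoc)
  then show "p = {c \<cdot>\<^sub>v u | c. True}"
    unfolding v(2) by blast
  show "u \<in> carrier_vec n - {0\<^sub>v n}" using u a v by auto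
qed

lemma projective_point_representative:
  assumes "p \<in> projective_space n"
  obtains u where "u \<in> p - {0\<^sub>v n}"
proof -
  obtain v where v: "v \<noteq> 0\<^sub>v n" "p = {c \<cdot>\<^sub>v v | c. True}"
    using assms by (auto simp: projective_space_def)
  have "v \<in> p" unfolding v(2) by (auto intro: exI[of _ 1])
  then show thesis using v that by blast
qed

lemma same_point_iff:
  assumes p: "p \<in> projective_space n" "u \<in> p - {0\<^sub>v n}"
    and q: "q \<in> projective_space n" "v \<in> q - {0\<^sub>v n}"
  shows "p = q \<longleftrightarrow> (\<exists>c. c \<noteq> 0 \<and> v = c \<cdot>\<^sub>v u)"
proof
  assume "p = q"
  then obtain c where c: "v = c \<cdot>\<^sub>v u" using q projective_point_span(2)[OF p] by blast
  moreover have "c \<noteq> 0"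
  proof
    assume "c = 0"
    then have "v = 0\<^sub>v n" using c projective_point_span(1)[OF p] by auto
    then show False using q by simp
  qed
  ultimately show "\<exists>c. c \<noteq> 0 \<and> v = c \<cdot>\<^sub>v u" by blast
next
  assume "\<exists>c. c \<noteq> 0 \<and> v = c \<cdot>\<^sub>v u"
  then have "v \<in> p - {0\<^sub>v n}" using q projective_point_span(2)[OF p] by blast
  then show "p = q"
    using projective_point_span(2)[OF p(1)] projective_point_span(2)[OF q] by metis
qed

lemma equiv_tail_rel: "equiv (point_sequences n) (tail_rel n)"
proof (rule equivI)
  show "tail_rel n \<subseteq> point_sequences n \<times> point_sequences n"
    by (auto simp: tail_rel_def)
  show "refl_on (point_sequences n) (tail_rel n)"
    by (auto simp: tail_rel_def intro: refl_onI)
  show "sym (tail_rel n)"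
    by (auto simp: tail_rel_def eq_commute intro: symI)
  show "trans (tail_rel n)"
    by (rule transI) (auto simp: tail_rel_def elim: eventually_elim2)
qed

lemma equiv_natural_iso: "equiv (natural_representations n) (natural_iso n)"
proof (rule equivI)
  show "natural_iso n \<subseteq> natural_representations n \<times> natural_representations n"
    by (auto simp: natural_iso_def)
  show "refl_on (natural_representations n) (natural_iso n)"
    by (auto simp: natural_iso_def lie_module_isomorphic_refl intro: refl_onI)
  show "sym (natural_iso n)"
    by (rule symI) (auto simp: natural_iso_def natural_representations_def
        intro: lie_module_isomorphic_sym)
  show "trans (natural_iso n)"
    by (rule transI) (auto simp: natural_iso_def intro: lie_module_isomorphic_trans)
qed

definition spans :: "nat \<Rightarrow> (nat \<Rightarrow> 'a::field vec) \<Rightarrow> (nat \<Rightarrow> 'a vec set) \<Rightarrow> bool"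
  where "spans n w p \<longleftrightarrow> p \<in> point_sequences n \<and> (\<forall>k. w k \<in> p k - {0\<^sub>v n})"

lemma spansD:
  assumes "spans n w p"
  shows "p k \<in> projective_space n" "w k \<in> p k - {0\<^sub>v n}" "w k \<in> carrier_vec n - {0\<^sub>v n}"
proof -
  show 1: "p k \<in> projective_space n" "w k \<in> p k - {0\<^sub>v n}"
    using assms by (auto simp: spans_def point_sequences_def)
  show "w k \<in> carrier_vec n - {0\<^sub>v n}" by (rule projective_point_span(1)[OF 1])
qed

lemma spans_exists:
  assumes "p \<in> point_sequences n"
  obtains w where "spans n w p"
proof -
  have "\<exists>u. u \<in> p k - {0\<^sub>v n}" for k
    using assms projective_point_representative[of "p k" n]
    by (auto simp: point_sequences_def)
  then obtain w where "\<forall>k. w k \<in> p k - {0\<^sub>v n}" by metis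
  then show thesis using assms that by (auto simp: spans_def)
qed

lemma natural_limit_iso_iff_tail:
  fixes w w' :: "nat \<Rightarrow> 'a::field vec"
  assumes p: "spans n w p" and q: "spans n w' q"
  shows "lie_module_isomorphic class_ring (sl_infinity n) (natural_limit n (\<lambda>k. block_vec (w k)))
      (natural_limit n (\<lambda>k. block_vec (w' k))) \<longleftrightarrow> (p, q) \<in> tail_rel n"
proof
  assume "lie_module_isomorphic class_ring (sl_infinity n) (natural_limit n (\<lambda>k. block_vec (w k)))
      (natural_limit n (\<lambda>k. block_vec (w' k)))"
  then have "\<exists>N. \<forall>k\<ge>N. \<exists>c. c \<noteq> 0 \<and> w' k = c \<cdot>\<^sub>v w k"
    by (rule isomorphic_limits_same_tail[OF spansD(3)[OF p] spansD(3)[OF q]])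
  then have "\<forall>\<^sub>F k in sequentially. p k = q k"
    unfolding eventually_sequentially
    using same_point_iff[OF spansD(1,2)[OF p] spansD(1,2)[OF q]] by blast
  then show "(p, q) \<in> tail_rel n" using p q by (simp add: tail_rel_def spans_def)
next
  assume "(p, q) \<in> tail_rel n"
  then obtain N where "\<And>k. N \<le> k \<Longrightarrow> p k = q k"
    by (auto simp: tail_rel_def eventually_sequentially)
  then have "\<exists>c. c \<noteq> 0 \<and> (N \<le> k \<longrightarrow> w' k = c \<cdot>\<^sub>v w k)" for k
    using same_point_iff[OF spansD(1,2)[OF p] spansD(1,2)[OF q], of k] by (metis zero_neq_one)
  then obtain c where c: "\<And>k. c k \<noteq> 0" "\<And>k. N \<le> k \<Longrightarrow> w' k = c k \<cdot>\<^sub>v w k"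
    by metis
  show "lie_module_isomorphic class_ring (sl_infinity n) (natural_limit n (\<lambda>k. block_vec (w k)))
      (natural_limit n (\<lambda>k. block_vec (w' k)))"
    by (rule natural_limits_isomorphic[OF natural_system_block_vec[OF spansD(3)[OF p]]
          natural_system_block_vec[OF spansD(3)[OF q]] c(1), where N = N])
      (simp add: c(2) block_vec_smult_left)
qed

text \<open>The class attached to a tail collects the modules isomorphic to some limit for some sequence in
  the tail.  All these limits are isomorphic, so one of them represents the class.\<close>

lemma natural_class_tail:
  fixes w :: "nat \<Rightarrow> 'a::field vec"
  assumes p: "spans n w p"
  shows "natural_class n (tail_rel n `` {p}) =
    natural_iso n `` {natural_limit n (\<lambda>k. block_vec (w k))}"
proof (intro equalityI subsetI)
  let ?lim = "\<lambda>w. natural_limit n (\<lambda>k. block_vec (w k))"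
  have rep: "?lim w \<in> natural_representations n"
    by (rule natural_limit_representation[OF natural_system_block_vec[OF spansD(3)[OF p]]])
  {
    fix V :: "('a, (nat \<times> 'a mat) set, (nat \<times> 'a vec) set) lie_module"
    assume "V \<in> natural_class n (tail_rel n `` {p})"
    then obtain q w' where V: "V \<in> natural_representations n"
      and q: "(p, q) \<in> tail_rel n" "\<forall>k. w' k \<in> q k - {0\<^sub>v n}"
      and iso: "lie_module_isomorphic class_ring (sl_infinity n) (?lim w') V"
      unfolding natural_class_def by auto
    have "spans n w' q" using q by (simp add: spans_def tail_rel_def)
    then have "lie_module_isomorphic class_ring (sl_infinity n) (?lim w) (?lim w')"
      using natural_limit_iso_iff_tail[OF p] q(1) by blast
    then show "V \<in> natural_iso n `` {?lim w}"
      using V rep iso lie_module_isomorphic_trans by (auto simp: natural_iso_def)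
  next
    fix V :: "('a, (nat \<times> 'a mat) set, (nat \<times> 'a vec) set) lie_module"
    assume "V \<in> natural_iso n `` {?lim w}"
    moreover have "(p, p) \<in> tail_rel n" using p by (simp add: tail_rel_def spans_def)
    ultimately show "V \<in> natural_class n (tail_rel n `` {p})"
      using p by (auto simp: natural_class_def natural_iso_def spans_def)
  }
qed

theorem proposition1p1:
  fixes n :: nat
  assumes "n \<ge> 2"
  shows "bij_betw
    (natural_class n ::
      (nat \<Rightarrow> 'a::{alg_closed_field, field_char_0} vec set) set \<Rightarrow>
      ('a, (nat \<times> 'a mat) set, (nat \<times> 'a vec) set) lie_module set)
    (point_sequences n // tail_rel n)
    (natural_representations n // natural_iso n)"
proof (rule bij_betw_imageI)
  let ?lim = "\<lambda>w :: nat \<Rightarrow> 'a vec. natural_limit n (\<lambda>k. block_vec (w k))"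
  let ?class = "natural_class n :: (nat \<Rightarrow> 'a vec set) set \<Rightarrow>
    ('a, (nat \<times> 'a mat) set, (nat \<times> 'a vec) set) lie_module set"
  have rep: "?lim w \<in> natural_representations n" if "spans n w p" for w p
    by (rule natural_limit_representation[OF natural_system_block_vec[OF spansD(3)[OF that]]])
  show "inj_on ?class (point_sequences n // tail_rel n)"
  proof (rule inj_onI)
    fix S T :: "(nat \<Rightarrow> 'a vec set) set"
    assume S: "S \<in> point_sequences n // tail_rel n" and T: "T \<in> point_sequences n // tail_rel n"
      and eq: "?class S = ?class T"
    obtain p where p: "p \<in> point_sequences n" "S = tail_rel n `` {p}"
      using S by (auto elim: quotientE)
    obtain q where q: "q \<in> point_sequences n" "T = tail_rel n `` {q}"
      using T by (auto elim: quotientE)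
    obtain w where w: "spans n w p" using spans_exists[OF p(1)] .
    obtain w' where w': "spans n w' q" using spans_exists[OF q(1)] .
    have "natural_iso n `` {?lim w} = natural_iso n `` {?lim w'}"
      using eq unfolding p q natural_class_tail[OF w] natural_class_tail[OF w'] .
    then have "(?lim w, ?lim w') \<in> natural_iso n"
      using eq_equiv_class[OF _ equiv_natural_iso rep[OF w']] by blast
    then have "(p, q) \<in> tail_rel n"
      using natural_limit_iso_iff_tail[OF w w'] by (simp add: natural_iso_def)
    then show "S = T"
      unfolding p q by (rule equiv_class_eq[OF equiv_tail_rel])
  qed
  show "?class ` (point_sequences n // tail_rel n) = natural_representations n // natural_iso n"
  proof (intro equalityI subsetI)
    fix C assume "C \<in> ?class ` (point_sequences n // tail_rel n)"
    then obtain p where p: "p \<in> point_sequences n" "C = ?class (tail_rel n `` {p})"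
      by (auto elim: quotientE)
    obtain w where w: "spans n w p" using spans_exists[OF p(1)] .
    show "C \<in> natural_representations n // natural_iso n"
      unfolding p natural_class_tail[OF w] by (rule quotientI[OF rep[OF w]])
  next
    fix C :: "('a, (nat \<times> 'a mat) set, (nat \<times> 'a vec) set) lie_module set"
    assume "C \<in> natural_representations n // natural_iso n"
    then obtain V where V: "V \<in> natural_representations n" "C = natural_iso n `` {V}"
      by (auto elim: quotientE)
    obtain \<phi> where \<phi>: "natural_system n \<phi>"
      and iso: "lie_module_isomorphic class_ring (sl_infinity n) (natural_limit n \<phi>) V"
      using V(1) by (auto simp: natural_representations_def)
    obtain w where w: "\<And>k. w k \<in> carrier_vec n - {0\<^sub>v n}"
      and \<phi>_w: "\<And>k x. x \<in> carrier_vec (n ^ (k + 1)) \<Longrightarrow> \<phi> k x = block_vec (w k) x"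
      using natural_system_obtain_block_vec[OF assms \<phi>] by blast
    define p where "p k = {c \<cdot>\<^sub>v w k | c. True}" for k
    have "w k \<in> p k" for k unfolding p_def by (auto intro: exI[of _ 1])
    moreover have "p k \<in> projective_space n" for k
      using w[of k] unfolding p_def projective_space_def by blast
    ultimately have p: "spans n w p"
      using w by (auto simp: spans_def point_sequences_def)
    have "lie_module_isomorphic class_ring (sl_infinity n) (?lim w) (natural_limit n \<phi>)"
      by (rule natural_limits_isomorphic[OF natural_system_block_vec[OF w] \<phi>, where c = "\<lambda>_. 1"])
        (simp_all add: \<phi>_w)
    then have "(?lim w, V) \<in> natural_iso n"
      using rep[OF p] V(1) iso lie_module_isomorphic_trans by (auto simp: natural_iso_def)
    then have "C = ?class (tail_rel n `` {p})"
      unfolding V(2) natural_class_tail[OF p]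
      by (rule equiv_class_eq[OF equiv_natural_iso, symmetric])
    then show "C \<in> ?class ` (point_sequences n // tail_rel n)"
      using p by (auto simp: spans_def intro!: quotientI)
  qed
qed

end
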